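(* Let $M$ be a smooth convex hypersurface in $\mathbb{E}^{n+1}$ and $p\in M$. Choose coordinates $(x,z)=(x_1,\dots,x_n,z)$ of $\mathbb{E}^{n+1}$ with origin $p$ such that the tangent hyperplane of $M$ at $p$ is $z=0$ and $M$ is locally the graph $z=f(x)$ of a nonnegative smooth convex function $f$ defined near $0$ with $f(0)=0$. For sufficiently small $t>0$ define $A_p(t)=\int_{f(x)<t}1\,dx$, $V_p(t)=\int_{f(x)<t}\{t-f(x)\}\,dx$, $S_p(t)=\int_{f(x)<t}\sqrt{1+|\nabla f|^2}\,dx$ (integration over the region around $0$ where $f<t$; these are the area of the section cut off by the hyperplane $z=t$, the volume of the cap between $M$ and $z=t$, and the surface area of the part of $M$ between $z=0$ and $z=t$). Suppose the Gauss–Kronecker curvature $K(p)$ of $M$ at $p$ with respect to the upward unit normal is positive. Then 1) $\lim_{t\to 0}\frac{A_p(t)}{(\sqrt t)^n}=\frac{(\sqrt2)^n\omega_n}{\sqrt{K(p)}}$; 2) $\lim_{t\to 0}\frac{V_p(t)}{(\sqrt t)^{n+2}}=\frac{(\sqrt2)^{n+2}\omega_n}{(n+2)\sqrt{K(p)}}$; 3) $\lim_{t\to 0}\frac{S_p(t)}{(\sqrt t)^n}=\frac{(\sqrt2)^n\omega_n}{\sqrt{K(p)}}$, where $\omega_n$ denotes the volume of the $n$-dimensional unit ball.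
   Context: $dx=dx_1\cdots dx_n$ and $\nabla f$ is the gradient of $f$. In these coordinates $K(p)=\det D^2f(0)$. *)

theory Defs
  imports "HOL-Analysis.Analysis"
begin

text \<open>Iterated partial derivatives of a real-valued function on real^'n.
  dpart [i1,...,ik] g is the partial derivative w.r.t. x_i1 of ... of
  the partial derivative w.r.t. x_ik of g.\<close>
fun dpart :: "'n::finite list \<Rightarrow> (real^'n \<Rightarrow> real) \<Rightarrow> real^'n \<Rightarrow> real" where
  "dpart [] g = g"
| "dpart (i # is) g = (\<lambda>x. deriv (\<lambda>s. dpart is g (x + s *\<^sub>R axis i 1)) 0)"

text \<open>Smoothness (C-infinity) on an open set U: all iterated partial
  derivatives exist on U and are continuous on U.\<close>
definition smooth_on :: "(real^'n::finite) set \<Rightarrow> (real^'n \<Rightarrow> real) \<Rightarrow> bool" where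
  "smooth_on U g \<longleftrightarrow>
     (\<forall>is. continuous_on U (dpart is g) \<and>
        (\<forall>x\<in>U. \<forall>i. ((\<lambda>s. dpart is g (x + s *\<^sub>R axis i 1))
              has_real_derivative dpart (i # is) g x) (at 0)))"

text \<open>Gradient and Hessian matrix.\<close>
definition grad :: "(real^'n::finite \<Rightarrow> real) \<Rightarrow> real^'n \<Rightarrow> real^'n" where
  "grad g x = (\<chi> i. dpart [i] g x)"

definition hessian :: "(real^'n::finite \<Rightarrow> real) \<Rightarrow> real^'n \<Rightarrow> real^'n^'n" where
  "hessian g x = (\<chi> i j. dpart [i, j] g x)"

text \<open>Volume of the n-dimensional unit ball.\<close>
definition unit_ball_volume :: "'n::finite itself \<Rightarrow> real" where
  "unit_ball_volume _ = measure lebesgue (ball (0 :: real^'n) 1)"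

end

theory Submission
  imports Defs
begin

text \<open>
  By Taylor's theorem \<open>f x = x \<bullet> (H *v x) / 2 + o(\<bar>x\<bar>\<^sup>2)\<close> with \<open>H\<close> the Hessian at \<open>0\<close>, which is
  symmetric, positive semidefinite because \<open>f\<close> has a minimum at \<open>0\<close>, and hence positive definite because
  \<open>det H > 0\<close>. So for every \<open>\<eta> \<in> (0, 1)\<close> and small \<open>t\<close> the sublevel set \<open>{f < t}\<close> (which
  shrinks to \<open>0\<close> by convexity) lies between the ellipsoids \<open>{x \<bullet> (H *v x) < 2 t / (1 \<plusminus> \<eta>)}\<close>, and
  \<open>t - f\<close> lies between the corresponding paraboloid caps. An ellipsoid \<open>{x \<bullet> (H *v x) < r}\<close> is the
  image of the ball of radius \<open>\<surd>r\<close> under a matrix \<open>T\<close> with \<open>T\<^sup>T H T = 1\<close>, so its volume is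
  \<open>\<surd>r\<^sup>n \<omega> / \<surd>(det H)\<close>; integrating over \<open>r\<close> gives the volume \<open>2 \<surd>r\<^sup>n\<^sup>+\<^sup>2 \<omega> / ((n + 2) \<surd>(det H))\<close>
  of the cap, and the area element \<open>\<surd>(1 + \<bar>\<nabla>f\<bar>\<^sup>2)\<close> tends to \<open>1\<close>. Letting \<open>\<eta> \<rightarrow> 0\<close> gives the limits.
\<close>

section \<open>Partial derivatives and second-order expansion\<close>

definition has_partials :: "(real^'n::finite) set \<Rightarrow> (real^'n \<Rightarrow> real) \<Rightarrow> ('n \<Rightarrow> real^'n \<Rightarrow> real) \<Rightarrow> bool"
  where "has_partials U g D \<longleftrightarrow>
    (\<forall>x\<in>U. \<forall>i. ((\<lambda>s. g (x + s *\<^sub>R axis i 1)) has_real_derivative D i x) (at 0))"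

lemma has_partials_DERIV:
  assumes "has_partials U g D" "x + s *\<^sub>R axis i 1 \<in> U"
  shows "((\<lambda>s. g (x + s *\<^sub>R axis i 1)) has_real_derivative D i (x + s *\<^sub>R axis i 1)) (at s)"
proof -
  let ?y = "x + s *\<^sub>R axis i 1"
  have "((\<lambda>u. g (?y + u *\<^sub>R axis i 1)) has_real_derivative D i ?y) (at 0)"
    using assms unfolding has_partials_def by blast
  moreover have "(\<lambda>u. g (?y + u *\<^sub>R axis i 1)) = (\<lambda>u. g (x + (u + s) *\<^sub>R axis i 1))"
    by (simp add: algebra_simps)
  ultimately show ?thesis
    using DERIV_shift[of "\<lambda>s. g (x + s *\<^sub>R axis i 1)" "D i ?y" 0 s] by simp
qed

lemma mean_value_abs:
  fixes \<phi> :: "real \<Rightarrow> real"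
  assumes "\<And>s. \<bar>s\<bar> \<le> \<bar>h\<bar> \<Longrightarrow> (\<phi> has_real_derivative \<phi>' s) (at s)"
  shows "\<exists>\<xi>. \<bar>\<xi>\<bar> \<le> \<bar>h\<bar> \<and> \<phi> h - \<phi> 0 = h * \<phi>' \<xi>"
proof -
  define diff where "diff m = (if m = 0 then \<phi> else \<phi>')" for m :: nat
  have "\<exists>\<xi>. \<bar>\<xi>\<bar> \<le> \<bar>h\<bar> \<and> diff 0 h = (\<Sum>m<1. diff m 0 / fact m * h ^ m) + diff 1 \<xi> / fact 1 * h ^ 1"
    by (rule Maclaurin_bi_le) (auto simp: diff_def intro: assms)
  then show ?thesis by (auto simp: diff_def)
qed

lemma partial_mean_value:
  assumes "has_partials U g D" "\<And>s. \<bar>s\<bar> \<le> \<bar>h\<bar> \<Longrightarrow> x + s *\<^sub>R axis i 1 \<in> U"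
  shows "\<exists>\<xi>. \<bar>\<xi>\<bar> \<le> \<bar>h\<bar> \<and> g (x + h *\<^sub>R axis i 1) - g x = h * D i (x + \<xi> *\<^sub>R axis i 1)"
  using mean_value_abs[of h "\<lambda>s. g (x + s *\<^sub>R axis i 1)"] has_partials_DERIV[OF assms(1) assms(2)]
  by simp

lemma isCont_uniform_finite:
  fixes D :: "'i::finite \<Rightarrow> 'a::metric_space \<Rightarrow> real"
  assumes "\<And>i. isCont (D i) x" "e > 0"
  shows "\<exists>d>0. \<forall>i y. dist y x < d \<longrightarrow> \<bar>D i y - D i x\<bar> < e"
proof -
  have "\<forall>\<^sub>F y in nhds x. \<forall>i. dist (D i y) (D i x) < e"
    using assms by (intro eventually_all_finite tendstoD) (simp_all add: isCont_def tendsto_at_iff_tendsto_nhds)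
  then show ?thesis by (auto simp: eventually_nhds_metric dist_real_def)
qed

definition coords_on :: "'n::finite set \<Rightarrow> real^'n \<Rightarrow> real^'n"
  where "coords_on S h = (\<chi> i. if i \<in> S then h $ i else 0)"

lemma coords_on_empty [simp]: "coords_on {} h = 0"
  by (simp add: coords_on_def vec_eq_iff)

lemma coords_on_UNIV [simp]: "coords_on UNIV h = h"
  by (simp add: coords_on_def vec_eq_iff)

lemma coords_on_insert: "k \<notin> S \<Longrightarrow> coords_on (insert k S) h = coords_on S h + h $ k *\<^sub>R axis k 1"
  by (auto simp: coords_on_def vec_eq_iff axis_def)

lemma norm_coords_on_axis_le:
  "k \<notin> S \<Longrightarrow> \<bar>s\<bar> \<le> \<bar>h $ k\<bar> \<Longrightarrow> norm (coords_on S h + s *\<^sub>R axis k 1) \<le> norm h"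
  by (rule norm_le_componentwise_cart) (auto simp: coords_on_def axis_def)

lemma has_partials_diff:
  "has_partials U g D \<Longrightarrow> has_partials U h E \<Longrightarrow> has_partials U (\<lambda>x. g x - h x) (\<lambda>i x. D i x - E i x)"
  unfolding has_partials_def by (auto intro!: DERIV_diff)

lemma has_partials_linear_form: "has_partials U (\<lambda>x. \<Sum>i\<in>UNIV. x $ i * c i) (\<lambda>i x. c i)"
proof -
  have "(x + s *\<^sub>R axis i 1) $ j * c j = x $ j * c j + (if j = i then s * c i else 0)"
    for x :: "real^'a" and s i j
    by (simp add: axis_def algebra_simps)
  then have "(\<lambda>s. \<Sum>j\<in>UNIV. (x + s *\<^sub>R axis i 1) $ j * c j) = (\<lambda>s. (\<Sum>j\<in>UNIV. x $ j * c j) + s * c i)"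
    for x :: "real^'a" and i
    by (simp add: sum.distrib)
  then show ?thesis
    unfolding has_partials_def by (auto intro!: derivative_eq_intros)
qed

lemma quadratic_form_add_axis:
  fixes M :: "real^'n::finite^'n"
  assumes "transpose M = M"
  shows "(p + a *\<^sub>R axis k 1) \<bullet> (M *v (p + a *\<^sub>R axis k 1))
    = p \<bullet> (M *v p) + 2 * a * (M *v p) $ k + a\<^sup>2 * M $ k $ k"
proof -
  have sym: "M $ i $ j = M $ j $ i" for i j
    using assms by (metis transpose_def vec_lambda_beta)
  have "p \<bullet> (M *v axis k 1) = (M *v p) $ k"
    by (simp add: matrix_vector_mult_def inner_vec_def axis_def sym mult.commute if_distrib cong: if_cong)
  moreover have "(M *v axis k 1) $ k = M $ k $ k"
    by (simp add: matrix_vector_mult_def axis_def if_distrib cong: if_cong)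
  ultimately show ?thesis
    by (simp add: matrix_vector_right_distrib inner_add_left inner_add_right matrix_vector_mult_scaleR
        inner_axis' power2_eq_square algebra_simps)
qed

lemma has_partials_quadratic_form:
  fixes M :: "real^'n::finite^'n"
  assumes "transpose M = M"
  shows "has_partials U (\<lambda>x. x \<bullet> (M *v x) / 2) (\<lambda>k x. (M *v x) $ k)"
  unfolding has_partials_def quadratic_form_add_axis[OF assms]
  by (auto intro!: derivative_eq_intros)

text \<open>Mean value inequality along the path that changes one coordinate at a time.\<close>
lemma coordinate_path_bound:
  fixes g :: "real^'n::finite \<Rightarrow> real"
    and B :: real
  assumes "has_partials U g D" "ball 0 r \<subseteq> U" "norm h < r"
    and "\<And>i y. norm y \<le> norm h \<Longrightarrow> \<bar>D i y\<bar> \<le> B"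
  shows "\<bar>g h - g 0\<bar> \<le> CARD('n) * B * norm h"
proof -
  have "\<bar>g (coords_on S h) - g 0\<bar> \<le> card S * B * norm h" if "finite S" for S
    using that
  proof (induction S rule: finite_induct)
    case (insert k S)
    let ?p = "coords_on S h"
    have "?p + s *\<^sub>R axis k 1 \<in> U" if "\<bar>s\<bar> \<le> \<bar>h $ k\<bar>" for s
      using norm_coords_on_axis_le[OF insert(2) that] assms(2,3) by auto
    then obtain \<xi> where \<xi>: "\<bar>\<xi>\<bar> \<le> \<bar>h $ k\<bar>"
        "g (?p + h $ k *\<^sub>R axis k 1) - g ?p = h $ k * D k (?p + \<xi> *\<^sub>R axis k 1)"
      using partial_mean_value[OF assms(1)] by blast
    have "\<bar>h $ k * D k (?p + \<xi> *\<^sub>R axis k 1)\<bar> \<le> norm h * B"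
      unfolding abs_mult
      by (intro mult_mono component_le_norm_cart assms(4) norm_coords_on_axis_le[OF insert(2) \<xi>(1)]) auto
    with insert \<xi>(2) show ?case
      by (simp add: coords_on_insert algebra_simps)
  qed simp
  from this[OF finite_class.finite_UNIV] show ?thesis by simp
qed

lemma first_order_expansion:
  fixes g :: "real^'n::finite \<Rightarrow> real"
  assumes "open U" "0 \<in> U" "has_partials U g D" "\<And>i. isCont (D i) 0" "\<epsilon> > 0"
  shows "\<forall>\<^sub>F h in nhds 0. \<bar>g h - g 0 - (\<Sum>i\<in>UNIV. h $ i * D i 0)\<bar> \<le> \<epsilon> * norm h"
proof -
  obtain d1 where d1: "d1 > 0" "ball 0 d1 \<subseteq> U"
    using assms(1,2) open_contains_ball by blast
  define e where "e = \<epsilon> / CARD('n)"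
  have "e > 0" using assms(5) by (simp add: e_def)
  then obtain d2 where d2: "d2 > 0" "\<And>i y. norm y < d2 \<Longrightarrow> \<bar>D i y - D i 0\<bar> < e"
    using isCont_uniform_finite[where D = D, OF assms(4)] by fastforce
  have "\<bar>g h - g 0 - (\<Sum>i\<in>UNIV. h $ i * D i 0)\<bar> \<le> \<epsilon> * norm h" if h: "norm h < min d1 d2" for h
  proof -
    have "\<bar>D i y - D i 0\<bar> \<le> e" if "norm y \<le> norm h" for i y
      using d2(2)[of y i] that h by simp
    then show ?thesis
      using coordinate_path_bound[OF has_partials_diff[OF assms(3) has_partials_linear_form[where c = "\<lambda>i. D i 0"]]
          d1(2), where h = h and B = e] h
      by (simp add: e_def)
  qed
  moreover have "min d1 d2 > 0" using d1 d2 by simp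
  ultimately show ?thesis
    unfolding eventually_nhds_metric dist_norm by (intro exI[of _ "min d1 d2"]) auto
qed

lemma second_difference_mean_value:
  fixes f :: "real^'n::finite \<Rightarrow> real"
  assumes f: "has_partials U f D1" and Df: "\<And>i. has_partials U (D1 i) (\<lambda>j. D2 j i)"
    and U: "\<And>u v. \<bar>u\<bar> \<le> \<bar>s\<bar> \<Longrightarrow> \<bar>v\<bar> \<le> \<bar>s\<bar> \<Longrightarrow> u *\<^sub>R axis i 1 + v *\<^sub>R axis j 1 \<in> U"
  shows "\<exists>\<xi> \<eta>. \<bar>\<xi>\<bar> \<le> \<bar>s\<bar> \<and> \<bar>\<eta>\<bar> \<le> \<bar>s\<bar> \<and>
    f (s *\<^sub>R axis i 1 + s *\<^sub>R axis j 1) - f (s *\<^sub>R axis i 1) - f (s *\<^sub>R axis j 1) + f 0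
      = s * s * D2 j i (\<xi> *\<^sub>R axis i 1 + \<eta> *\<^sub>R axis j 1)"
proof -
  have "((\<lambda>u. f (s *\<^sub>R axis j 1 + u *\<^sub>R axis i 1) - f (0 + u *\<^sub>R axis i 1)) has_real_derivative
      D1 i (s *\<^sub>R axis j 1 + u *\<^sub>R axis i 1) - D1 i (0 + u *\<^sub>R axis i 1)) (at u)"
    if "\<bar>u\<bar> \<le> \<bar>s\<bar>" for u
    using U[OF that, of s] U[OF that, of 0]
    by (intro DERIV_diff has_partials_DERIV[OF f]) (simp_all add: add.commute)
  from mean_value_abs[where h = s, OF this] obtain \<xi> where \<xi>: "\<bar>\<xi>\<bar> \<le> \<bar>s\<bar>"
    "f (s *\<^sub>R axis i 1 + s *\<^sub>R axis j 1) - f (s *\<^sub>R axis i 1) - f (s *\<^sub>R axis j 1) + f 0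
      = s * (D1 i (\<xi> *\<^sub>R axis i 1 + s *\<^sub>R axis j 1) - D1 i (\<xi> *\<^sub>R axis i 1))"
    by (auto simp: add.commute algebra_simps)
  obtain \<eta> where "\<bar>\<eta>\<bar> \<le> \<bar>s\<bar>" "D1 i (\<xi> *\<^sub>R axis i 1 + s *\<^sub>R axis j 1) - D1 i (\<xi> *\<^sub>R axis i 1)
      = s * D2 j i (\<xi> *\<^sub>R axis i 1 + \<eta> *\<^sub>R axis j 1)"
    using partial_mean_value[OF Df U[OF \<xi>(1)]] by blast
  with \<xi> show ?thesis by (intro exI[of _ \<xi>] exI[of _ \<eta>]) simp
qed

lemma second_difference_quotient_tendsto:
  fixes f :: "real^'n::finite \<Rightarrow> real"
  assumes "open U" "0 \<in> U" and f: "has_partials U f D1" and Df: "\<And>i. has_partials U (D1 i) (\<lambda>j. D2 j i)"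
    and cont: "isCont (D2 j i) 0"
  shows "((\<lambda>s. (f (s *\<^sub>R axis i 1 + s *\<^sub>R axis j 1) - f (s *\<^sub>R axis i 1) - f (s *\<^sub>R axis j 1) + f 0)
    / (s * s)) \<longlongrightarrow> D2 j i 0) (at 0)"
proof (rule tendstoI)
  fix e :: real assume "e > 0"
  obtain d1 where d1: "d1 > 0" "ball 0 d1 \<subseteq> U"
    using assms(1,2) open_contains_ball by blast
  obtain d2 where d2: "d2 > 0" "\<And>y. norm y < d2 \<Longrightarrow> \<bar>D2 j i y - D2 j i 0\<bar> < e"
    using cont \<open>e > 0\<close> by (force simp: continuous_at_eps_delta dist_norm)
  have "dist ((f (s *\<^sub>R axis i 1 + s *\<^sub>R axis j 1) - f (s *\<^sub>R axis i 1) - f (s *\<^sub>R axis j 1) + f 0)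
    / (s * s)) (D2 j i 0) < e" if "s \<noteq> 0" "\<bar>s\<bar> < min d1 d2 / 2" for s
  proof -
    have small: "norm (u *\<^sub>R axis i 1 + v *\<^sub>R axis j (1::real)) < min d1 d2"
      if "\<bar>u\<bar> \<le> \<bar>s\<bar>" "\<bar>v\<bar> \<le> \<bar>s\<bar>" for u v
      using norm_triangle_ineq[of "u *\<^sub>R axis i (1::real)" "v *\<^sub>R axis j 1"] that \<open>\<bar>s\<bar> < min d1 d2 / 2\<close>
      by (simp add: norm_axis_1)
    then have "u *\<^sub>R axis i 1 + v *\<^sub>R axis j 1 \<in> U" if "\<bar>u\<bar> \<le> \<bar>s\<bar>" "\<bar>v\<bar> \<le> \<bar>s\<bar>" for u v
      using that d1(2) by fastforce
    then obtain \<xi> \<eta> where "\<bar>\<xi>\<bar> \<le> \<bar>s\<bar>" "\<bar>\<eta>\<bar> \<le> \<bar>s\<bar>"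
      "f (s *\<^sub>R axis i 1 + s *\<^sub>R axis j 1) - f (s *\<^sub>R axis i 1) - f (s *\<^sub>R axis j 1) + f 0
        = s * s * D2 j i (\<xi> *\<^sub>R axis i 1 + \<eta> *\<^sub>R axis j 1)"
      using second_difference_mean_value[OF f Df] by blast
    with small d2(2) \<open>s \<noteq> 0\<close> show ?thesis by (simp add: dist_real_def)
  qed
  moreover have "min d1 d2 / 2 > 0" using d1 d2 by simp
  ultimately show "\<forall>\<^sub>F s in at 0. dist ((f (s *\<^sub>R axis i 1 + s *\<^sub>R axis j 1) - f (s *\<^sub>R axis i 1)
      - f (s *\<^sub>R axis j 1) + f 0) / (s * s)) (D2 j i 0) < e"
    unfolding eventually_at by (metis dist_real_def diff_zero)
qed

text \<open>Schwarz's theorem: both second partials are limits of the same second difference quotient.\<close>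
lemma partials_commute:
  fixes f :: "real^'n::finite \<Rightarrow> real"
  assumes "open U" "0 \<in> U" "has_partials U f D1" "\<And>i. has_partials U (D1 i) (\<lambda>j. D2 j i)"
    and "\<And>i j. isCont (D2 i j) 0"
  shows "D2 i j 0 = D2 j i 0"
proof -
  have "(\<lambda>s. (f (s *\<^sub>R axis j 1 + s *\<^sub>R axis i 1) - f (s *\<^sub>R axis j 1) - f (s *\<^sub>R axis i 1) + f 0) / (s * s))
    = (\<lambda>s. (f (s *\<^sub>R axis i 1 + s *\<^sub>R axis j 1) - f (s *\<^sub>R axis i 1) - f (s *\<^sub>R axis j 1) + f 0) / (s * s))"
    by (simp add: add.commute algebra_simps)
  then have "((\<lambda>s. (f (s *\<^sub>R axis i 1 + s *\<^sub>R axis j 1) - f (s *\<^sub>R axis i 1) - f (s *\<^sub>R axis j 1) + f 0)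
    / (s * s)) \<longlongrightarrow> D2 i j 0) (at 0)"
    using second_difference_quotient_tendsto[OF assms, of j i] by simp
  then show ?thesis
    using tendsto_unique[OF at_neq_bot] second_difference_quotient_tendsto[OF assms, of i j] by blast
qed

lemma second_order_expansion:
  fixes f :: "real^'n::finite \<Rightarrow> real"
  assumes U: "open U" "0 \<in> U" and f: "has_partials U f D1"
    and Df: "\<And>i. has_partials U (D1 i) (\<lambda>j. D2 j i)" and cont: "\<And>i j. isCont (D2 i j) 0"
    and "\<epsilon> > 0"
  shows "\<forall>\<^sub>F h in nhds 0.
    \<bar>f h - f 0 - (\<Sum>i\<in>UNIV. h $ i * D1 i 0) - h \<bullet> ((\<chi> i j. D2 i j 0) *v h) / 2\<bar> \<le> \<epsilon> * (norm h)\<^sup>2"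
proof -
  define M :: "real^'n^'n" where "M = (\<chi> i j. D2 i j 0)"
  have M_sym: "transpose M = M"
    using partials_commute[OF U f Df cont] by (simp add: M_def transpose_def vec_eq_iff)
  have M_row: "(M *v y) $ k = (\<Sum>j\<in>UNIV. y $ j * D2 j k 0)" for y k
    by (simp add: matrix_vector_mult_def M_def mult.commute partials_commute[OF U f Df cont, of k])
  obtain d1 where d1: "d1 > 0" "ball 0 d1 \<subseteq> U"
    using U open_contains_ball by blast
  define e where "e = \<epsilon> / CARD('n)"
  have "e > 0" using \<open>\<epsilon> > 0\<close> by (simp add: e_def)
  \<comment> \<open>The partials of the remainder are the remainders of the first-order expansions of the partials.\<close>
  have "\<forall>\<^sub>F y in nhds 0. \<forall>k. \<bar>D1 k y - D1 k 0 - (\<Sum>j\<in>UNIV. y $ j * D2 j k 0)\<bar> \<le> e * norm y"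
    using \<open>e > 0\<close> by (intro eventually_all_finite first_order_expansion[OF U Df]) (simp_all add: cont)
  then obtain d2 where d2: "d2 > 0"
    "\<And>k y. norm y < d2 \<Longrightarrow> \<bar>D1 k y - D1 k 0 - (M *v y) $ k\<bar> \<le> e * norm y"
    by (auto simp: eventually_nhds_metric dist_norm M_row)
  have "\<bar>f h - f 0 - (\<Sum>i\<in>UNIV. h $ i * D1 i 0) - h \<bullet> (M *v h) / 2\<bar> \<le> \<epsilon> * (norm h)\<^sup>2"
    if h: "norm h < min d1 d2" for h
  proof -
    have "\<bar>D1 k y - D1 k 0 - (M *v y) $ k\<bar> \<le> e * norm h" if "norm y \<le> norm h" for k y
    proof -
      have "\<bar>D1 k y - D1 k 0 - (M *v y) $ k\<bar> \<le> e * norm y"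
        using d2(2)[of y k] that h by simp
      also have "\<dots> \<le> e * norm h"
        using that \<open>e > 0\<close> by simp
      finally show ?thesis .
    qed
    then show ?thesis
      using coordinate_path_bound[OF has_partials_diff[OF has_partials_diff[OF f
          has_partials_linear_form[where c = "\<lambda>i. D1 i 0"]]
          has_partials_quadratic_form[OF M_sym]] d1(2), where h = h and B = "e * norm h"] h
      by (simp add: e_def power2_eq_square algebra_simps)
  qed
  moreover have "min d1 d2 > 0" using d1 d2 by simp
  ultimately show ?thesis
    unfolding eventually_nhds_metric dist_norm M_def by (intro exI[of _ "min d1 d2"]) auto
qed

lemma smooth_on_has_partials: "smooth_on U f \<Longrightarrow> has_partials U (dpart is f) (\<lambda>i. dpart (i # is) f)"
  unfolding smooth_on_def has_partials_def by blast

lemma smooth_on_isCont: "smooth_on U f \<Longrightarrow> open U \<Longrightarrow> x \<in> U \<Longrightarrow> isCont (dpart is f) x"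
  unfolding smooth_on_def using continuous_on_eq_continuous_at by blast

lemma hessian_symmetric:
  assumes "open U" "0 \<in> U" "smooth_on U f"
  shows "transpose (hessian f 0) = hessian f 0"
  using partials_commute[OF assms(1,2) smooth_on_has_partials[OF assms(3), of "[]"]
      smooth_on_has_partials[OF assms(3)] smooth_on_isCont[OF assms(3,1,2)]]
  by (simp add: hessian_def transpose_def vec_eq_iff del: dpart.simps)

lemma smooth_quadratic_expansion:
  assumes "open U" "0 \<in> U" "smooth_on U f" "grad f 0 = 0" "\<epsilon> > 0"
  shows "\<forall>\<^sub>F h in nhds 0. \<bar>f h - f 0 - h \<bullet> (hessian f 0 *v h) / 2\<bar> \<le> \<epsilon> * (norm h)\<^sup>2"
proof -
  have "dpart [i] f 0 = 0" for i
    using assms(4) unfolding grad_def by (metis vec_lambda_beta zero_index)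
  then show ?thesis
    using second_order_expansion[OF assms(1,2) smooth_on_has_partials[OF assms(3), of "[]"]
        smooth_on_has_partials[OF assms(3)] smooth_on_isCont[OF assms(3,1,2)] assms(5)]
    by (simp add: hessian_def del: dpart.simps(2))
qed

section \<open>Quadratic forms\<close>

lemma quadratic_form_symmetric:
  fixes H :: "real^'n::finite^'n"
  assumes "transpose H = H"
  shows "u \<bullet> (H *v v) = v \<bullet> (H *v u)"
  by (metis assms dot_lmul_matrix inner_commute transpose_matrix_vector)

lemma quadratic_form_scaleR:
  fixes H :: "real^'n::finite^'n"
  shows "(c *\<^sub>R x) \<bullet> (H *v (c *\<^sub>R x)) = c\<^sup>2 * (x \<bullet> (H *v x))"
  by (simp add: matrix_vector_mult_scaleR power2_eq_square)

lemma local_min_quadratic_form_nonneg: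
  fixes H :: "real^'n::finite^'n" and f :: "real^'n \<Rightarrow> real"
  assumes expansion: "\<And>\<epsilon>. \<epsilon> > 0 \<Longrightarrow> \<forall>\<^sub>F h in nhds 0. \<bar>f h - f 0 - h \<bullet> (H *v h) / 2\<bar> \<le> \<epsilon> * (norm h)\<^sup>2"
    and min: "\<forall>\<^sub>F h in nhds 0. f 0 \<le> f h"
  shows "x \<bullet> (H *v x) \<ge> 0"
proof (rule ccontr)
  assume neg: "\<not> x \<bullet> (H *v x) \<ge> 0"
  then have "norm x > 0" by auto
  define \<epsilon> where "\<epsilon> = - (x \<bullet> (H *v x)) / (4 * (norm x)\<^sup>2)"
  have "\<epsilon> > 0" using neg \<open>norm x > 0\<close> unfolding \<epsilon>_def by (intro divide_pos_pos) auto
  then have "\<forall>\<^sub>F h in nhds 0. \<bar>f h - f 0 - h \<bullet> (H *v h) / 2\<bar> \<le> \<epsilon> * (norm h)\<^sup>2 \<and> f 0 \<le> f h"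
    using expansion min by (auto intro: eventually_conj)
  then obtain d where d: "d > 0"
    "\<And>h. norm h < d \<Longrightarrow> \<bar>f h - f 0 - h \<bullet> (H *v h) / 2\<bar> \<le> \<epsilon> * (norm h)\<^sup>2 \<and> f 0 \<le> f h"
    by (auto simp: eventually_nhds_metric dist_norm)
  define s where "s = d / (2 * norm x)"
  have "s > 0" "norm (s *\<^sub>R x) < d" using d \<open>norm x > 0\<close> by (auto simp: s_def)
  then have "0 \<le> (s *\<^sub>R x) \<bullet> (H *v (s *\<^sub>R x)) / 2 + \<epsilon> * (norm (s *\<^sub>R x))\<^sup>2"
    using d(2) by fastforce
  also have "\<dots> = s\<^sup>2 * (x \<bullet> (H *v x)) / 4"
    unfolding quadratic_form_scaleR using \<open>norm x > 0\<close> by (simp add: power_mult_distrib \<epsilon>_def field_simps)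
  also have "\<dots> < 0" using \<open>s > 0\<close> neg by (simp add: mult_pos_neg)
  finally show False by simp
qed

lemma quadratic_form_pos_def:
  fixes H :: "real^'n::finite^'n"
  assumes sym: "transpose H = H" and nonneg: "\<And>x. x \<bullet> (H *v x) \<ge> 0" and "det H \<noteq> 0"
    and "v \<noteq> 0"
  shows "v \<bullet> (H *v v) > 0"
proof (rule ccontr)
  assume "\<not> v \<bullet> (H *v v) > 0"
  with nonneg[of v] have "v \<bullet> (H *v v) = 0" by simp
  define w where "w = H *v v"
  have expand: "(v + s *\<^sub>R w) \<bullet> (H *v (v + s *\<^sub>R w)) = 2 * s * (w \<bullet> w) + s\<^sup>2 * (w \<bullet> (H *v w))" for s
    using \<open>v \<bullet> (H *v v) = 0\<close> quadratic_form_symmetric[OF sym, of v w]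
    by (simp add: matrix_vector_right_distrib matrix_vector_mult_scaleR inner_add_left inner_add_right
        power2_eq_square w_def algebra_simps)
  have "w = 0"
  proof (rule ccontr)
    assume "w \<noteq> 0"
    define q where "q = w \<bullet> (H *v w)"
    define s where "s = - (w \<bullet> w) / (q + 1)"
    have "q \<ge> 0" "w \<bullet> w > 0" using nonneg \<open>w \<noteq> 0\<close> by (auto simp: q_def)
    have "s\<^sup>2 * q = (w \<bullet> w)\<^sup>2 * q / (q + 1)\<^sup>2" by (simp add: s_def power_divide)
    also have "\<dots> \<le> (w \<bullet> w)\<^sup>2 / (q + 1)"
      using \<open>q \<ge> 0\<close> by (simp add: power2_eq_square divide_simps) (simp add: mult_left_mono)
    finally have "s\<^sup>2 * q \<le> (w \<bullet> w)\<^sup>2 / (q + 1)" .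
    moreover have "2 * s * (w \<bullet> w) = - 2 * (w \<bullet> w)\<^sup>2 / (q + 1)"
      by (simp add: s_def power2_eq_square)
    moreover have "(w \<bullet> w)\<^sup>2 / (q + 1) > 0" using \<open>q \<ge> 0\<close> \<open>w \<bullet> w > 0\<close> by simp
    ultimately have "2 * s * (w \<bullet> w) + s\<^sup>2 * q < 0" by linarith
    then show False using nonneg[of "v + s *\<^sub>R w"] expand[of s, folded q_def] by linarith
  qed
  then have "H *v v = 0" by (simp add: w_def)
  moreover have "inj ((*v) H)"
    using \<open>det H \<noteq> 0\<close> det_nz_iff_inj[OF matrix_vector_mul_linear[of H]]
    by (simp add: matrix_of_matrix_vector_mul)
  ultimately show False using \<open>v \<noteq> 0\<close> by (simp add: vec.inj_iff_eq_0)
qed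

lemma quadratic_form_coercive:
  fixes H :: "real^'n::finite^'n"
  assumes pd: "\<And>x. x \<noteq> 0 \<Longrightarrow> x \<bullet> (H *v x) > 0"
  obtains c where "c > 0" "\<And>x. c * (norm x)\<^sup>2 \<le> x \<bullet> (H *v x)"
proof -
  have "continuous_on (sphere 0 1) (\<lambda>x. x \<bullet> (H *v x))"
    by (intro continuous_intros matrix_vector_mult_linear_continuous_on[THEN continuous_on_compose2[of UNIV]])
      auto
  moreover have "sphere (0::real^'n) 1 \<noteq> {}" by simp
  ultimately obtain x0 where x0: "x0 \<in> sphere 0 1" "\<And>y. y \<in> sphere 0 1 \<Longrightarrow> x0 \<bullet> (H *v x0) \<le> y \<bullet> (H *v y)"
    using continuous_attains_inf[OF compact_sphere] by blast
  have "x0 \<bullet> (H *v x0) * (norm x)\<^sup>2 \<le> x \<bullet> (H *v x)" for x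
  proof (cases "x = 0")
    case False
    then have "x0 \<bullet> (H *v x0) \<le> (inverse (norm x) *\<^sub>R x) \<bullet> (H *v (inverse (norm x) *\<^sub>R x))"
      by (intro x0(2)) simp
    also have "\<dots> = (x \<bullet> (H *v x)) / (norm x)\<^sup>2"
      unfolding quadratic_form_scaleR by (simp add: power_inverse divide_inverse_commute)
    finally show ?thesis using False by (simp add: field_simps)
  qed simp
  moreover have "x0 \<bullet> (H *v x0) > 0" using x0(1) by (intro pd) auto
  ultimately show ?thesis using that by blast
qed

lemma column_update_injective:
  fixes T T' :: "real^'n::finite^'n"
  assumes inj: "\<And>x. T *v x = 0 \<Longrightarrow> x = 0" and "\<beta> k \<noteq> -1" and "T' *v x = 0"
    and col: "\<And>j. column j T' = column j T + \<beta> j *\<^sub>R column k T"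
  shows "x = 0"
proof -
  define \<gamma> where "\<gamma> = (\<Sum>j\<in>UNIV. x $ j * \<beta> j)"
  have "T' *v x = (\<Sum>j\<in>UNIV. x $ j *\<^sub>R column j T) + \<gamma> *\<^sub>R column k T"
    by (simp add: matrix_mult_sum[of T'] col scalar_mult_eq_scaleR scaleR_add_right sum.distrib
        scaleR_sum_left \<gamma>_def)
  also have "(\<Sum>j\<in>UNIV. x $ j *\<^sub>R column j T) = T *v x"
    by (simp add: matrix_mult_sum[of T] scalar_mult_eq_scaleR)
  also have "T *v x + \<gamma> *\<^sub>R column k T = T *v (x + \<gamma> *\<^sub>R axis k 1)"
    by (simp add: matrix_vector_right_distrib matrix_vector_mult_scaleR matrix_vector_mult_basis)
  finally have y: "x + \<gamma> *\<^sub>R axis k 1 = 0" using inj assms(3) by simp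
  have "x $ j = 0" if "j \<noteq> k" for j
  proof -
    have "(x + \<gamma> *\<^sub>R axis k 1) $ j = 0" using y by simp
    with that show ?thesis by (simp add: axis_def)
  qed
  then have "\<gamma> = x $ k * \<beta> k"
    unfolding \<gamma>_def by (subst sum.remove[of _ k]) auto
  moreover have "(x + \<gamma> *\<^sub>R axis k 1) $ k = 0" using y by simp
  ultimately have "x $ k * (1 + \<beta> k) = 0"
    by (simp add: axis_def algebra_simps)
  with \<open>\<beta> k \<noteq> -1\<close> \<open>\<And>j. j \<noteq> k \<Longrightarrow> x $ j = 0\<close> show ?thesis
    by (metis vec_eq_iff zero_index mult_eq_0_iff add_eq_0_iff)
qed

lemma quadratic_form_orthonormalize_step:
  fixes H T :: "real^'n::finite^'n"
  assumes sym: "transpose H = H" and pd: "\<And>x. x \<noteq> 0 \<Longrightarrow> x \<bullet> (H *v x) > 0"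
    and inj: "\<And>x. T *v x = 0 \<Longrightarrow> x = 0"
    and orth: "\<And>i j. i \<in> S \<Longrightarrow> column i T \<bullet> (H *v column j T) = (if i = j then 1 else 0)"
    and "k \<notin> S"
  obtains T' where "\<And>x. T' *v x = 0 \<Longrightarrow> x = 0"
    "\<And>i j. i \<in> insert k S \<Longrightarrow> column i T' \<bullet> (H *v column j T') = (if i = j then 1 else 0)"
proof -
  define c where "c j = column j T" for j
  define B where "B u v = u \<bullet> (H *v v)" for u v
  have B_sym: "B u v = B v u" for u v
    unfolding B_def by (rule quadratic_form_symmetric[OF sym])
  have "c k \<noteq> 0"
    using inj[of "axis k 1"] by (auto simp: c_def matrix_vector_mult_basis axis_eq_0_iff)
  define a where "a = B (c k) (c k)"
  have "a > 0" using pd[OF \<open>c k \<noteq> 0\<close>] by (simp add: a_def B_def)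
  define r where "r = 1 / sqrt a"
  have "r > 0" "r * r * a = 1" using \<open>a > 0\<close> by (auto simp: r_def)
  \<comment> \<open>Subtract from every column its \<open>B\<close>-projection onto \<open>c k\<close>, and normalise \<open>c k\<close>.\<close>
  define \<beta> where "\<beta> j = (if j = k then r - 1 else - B (c k) (c j) / a)" for j
  define T' where "T' = (\<chi> l j. c j $ l + \<beta> j * c k $ l)"
  have col: "column j T' = c j + \<beta> j *\<^sub>R c k" for j
    by (simp add: T'_def column_def vec_eq_iff)
  have B_col: "B (column i T') (column j T') = B (c i) (c j) + \<beta> j * B (c i) (c k)
      + \<beta> i * B (c k) (c j) + \<beta> i * \<beta> j * a" for i j
    unfolding col B_def a_def
    by (simp add: matrix_vector_right_distrib matrix_vector_mult_scaleR inner_add_left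
        inner_add_right algebra_simps)
  have "B (column i T') (column j T') = (if i = j then 1 else 0)" if "i \<in> insert k S" for i j
  proof (cases "i = k")
    case True
    then have "B (column i T') (column j T') = r * (B (c k) (c j) + \<beta> j * a)"
      unfolding B_col using B_sym[of "c k" "c k"] by (simp add: \<beta>_def a_def algebra_simps)
    also have "\<dots> = (if i = j then 1 else 0)"
    proof (cases "j = k")
      case True
      then have "r * (B (c k) (c j) + \<beta> j * a) = r * r * a"
        by (simp add: \<beta>_def a_def algebra_simps)
      with \<open>i = k\<close> \<open>j = k\<close> \<open>r * r * a = 1\<close> show ?thesis by simp
    next
      case False
      with \<open>i = k\<close> \<open>a > 0\<close> show ?thesis by (simp add: \<beta>_def field_simps)
    qed
    finally show ?thesis .
  next
    case False
    with that have "i \<in> S" by simp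
    then have "B (c i) (c k) = 0" "B (c k) (c i) = 0"
      using orth[of i k] False B_sym by (auto simp: B_def c_def)
    with False orth[OF \<open>i \<in> S\<close>, of j] show ?thesis
      unfolding B_col by (simp add: \<beta>_def B_def c_def)
  qed
  moreover have "x = 0" if "T' *v x = 0" for x
    using column_update_injective[OF inj _ that, where \<beta> = \<beta> and k = k] \<open>r > 0\<close>
    by (simp add: col c_def \<beta>_def)
  ultimately show ?thesis using that unfolding B_def by blast
qed

lemma bilinear_form_congruence:
  fixes H T :: "real^'n::finite^'n"
  shows "(T *v u) \<bullet> (H *v (T *v v)) = u \<bullet> ((transpose T ** H ** T) *v v)"
proof -
  have "(T *v u) \<bullet> (H *v (T *v v)) = (u v* transpose T) \<bullet> (H *v (T *v v))"
    by (metis transpose_matrix_vector transpose_transpose)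
  also have "\<dots> = u \<bullet> ((transpose T ** H ** T) *v v)"
    by (simp only: dot_lmul_matrix matrix_vector_mul_assoc matrix_mul_assoc)
  finally show ?thesis .
qed
lemma quadratic_form_congruent_identity:
  fixes H :: "real^'n::finite^'n"
  assumes sym: "transpose H = H" and pd: "\<And>x. x \<noteq> 0 \<Longrightarrow> x \<bullet> (H *v x) > 0"
  obtains T :: "real^'n^'n" where "transpose T ** H ** T = mat 1"
proof -
  have "\<exists>T :: real^'n^'n. (\<forall>x. T *v x = 0 \<longrightarrow> x = 0) \<and>
      (\<forall>i\<in>S. \<forall>j. column i T \<bullet> (H *v column j T) = (if i = j then 1 else 0))"
    if "finite S" for S :: "'n set"
    using that
  proof (induction S rule: finite_induct)
    case empty
    show ?case by (intro exI[of _ "mat 1"]) (simp add: matrix_vector_mul_lid)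
  next
    case (insert k S)
    then obtain T :: "real^'n^'n" where T: "\<And>x. T *v x = 0 \<Longrightarrow> x = 0"
      "\<And>i j. i \<in> S \<Longrightarrow> column i T \<bullet> (H *v column j T) = (if i = j then 1 else 0)"
      by blast
    obtain T' :: "real^'n^'n" where "\<And>x. T' *v x = 0 \<Longrightarrow> x = 0"
      "\<And>i j. i \<in> insert k S \<Longrightarrow> column i T' \<bullet> (H *v column j T') = (if i = j then 1 else 0)"
      using quadratic_form_orthonormalize_step[OF sym pd T insert(2)] by blast
    then show ?case by blast
  qed
  from this[OF finite_class.finite_UNIV] obtain T :: "real^'n^'n"
    where "\<forall>i\<in>UNIV. \<forall>j. column i T \<bullet> (H *v column j T) = (if i = j then 1 else 0)"
    by blast
  then have T: "column i T \<bullet> (H *v column j T) = (if i = j then 1 else 0)" for i j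
    by blast
  have "(transpose T ** H ** T) $ i $ j = column i T \<bullet> (H *v column j T)" for i j
    using bilinear_form_congruence[of T "axis i 1" H "axis j 1"]
    by (simp add: matrix_vector_mult_basis column_def inner_axis')
  then have "transpose T ** H ** T = mat 1"
    by (simp add: T vec_eq_iff mat_def)
  then show ?thesis by (rule that)
qed

section \<open>Lebesgue measure of linear images\<close>

text \<open>The change-of-variables formula \<open>measure_linear_image\<close> is stated for wellordered index types
  only. It is transported to an arbitrary finite index type through a wellordered copy of that type
  and the corresponding relabelling of coordinates.\<close>

typedef 'a ordered = "UNIV :: 'a set" by simp

instance ordered :: (finite) finite
proof
  from finite_imageI[OF finite_class.finite_UNIV, of Abs_ordered]
  show "finite (UNIV :: 'a ordered set)"
    unfolding type_definition.Abs_image[OF type_definition_ordered] .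
qed

instantiation ordered :: (finite) wellorder
begin

definition less_eq_ordered :: "'a ordered \<Rightarrow> 'a ordered \<Rightarrow> bool"
  where "x \<le> y \<longleftrightarrow> to_nat (Rep_ordered x) \<le> to_nat (Rep_ordered y)"

definition less_ordered :: "'a ordered \<Rightarrow> 'a ordered \<Rightarrow> bool"
  where "x < y \<longleftrightarrow> to_nat (Rep_ordered x) < to_nat (Rep_ordered y)"

instance
proof
  fix x y z :: "'a ordered"
  show "x < y \<longleftrightarrow> x \<le> y \<and> \<not> y \<le> x"
    unfolding less_eq_ordered_def less_ordered_def by (rule less_le_not_le)
  show "x \<le> x"
    unfolding less_eq_ordered_def by (rule order_refl)
  show "x \<le> y \<or> y \<le> x"
    unfolding less_eq_ordered_def by (rule nat_le_linear)
  show "x \<le> y \<Longrightarrow> y \<le> z \<Longrightarrow> x \<le> z"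
    by (simp add: less_eq_ordered_def)
  show "x \<le> y \<Longrightarrow> y \<le> x \<Longrightarrow> x = y"
    unfolding less_eq_ordered_def
    using inj_to_nat[where 'a='a] by (simp add: inj_eq Rep_ordered_inject)
next
  fix P :: "'a ordered \<Rightarrow> bool" and a
  assume step: "\<And>x. (\<And>y. y < x \<Longrightarrow> P y) \<Longrightarrow> P x"
  show "P a"
  proof (induction a rule: measure_induct_rule[where f = "\<lambda>x. to_nat (Rep_ordered x)"])
    case (less x)
    then have "\<And>y. y < x \<Longrightarrow> P y" by (simp add: less_ordered_def)
    then show ?case by (rule step)
  qed
qed

end

definition relabel :: "('m \<Rightarrow> 'n) \<Rightarrow> real^'n \<Rightarrow> real^'m"
  where "relabel r x = (\<chi> i. x $ r i)"

lemma relabel_inv: "bij r \<Longrightarrow> relabel (inv r) (relabel r x) = x"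
  by (simp add: relabel_def vec_eq_iff surj_f_inv_f bij_is_surj)

lemma relabel_inv': "bij r \<Longrightarrow> relabel r (relabel (inv r) y) = y"
  by (simp add: relabel_def vec_eq_iff inv_f_f bij_is_inj)

lemma linear_relabel: "linear (relabel r)"
  by (rule linearI) (simp_all add: relabel_def vec_eq_iff)

lemma isCont_relabel: "isCont (relabel r) x"
  by (intro linear_continuous_at) (simp add: linear_linear linear_relabel)

lemma relabel_cbox:
  assumes "bij r"
  shows "relabel r ` cbox a b = cbox (relabel r a) (relabel r b)"
proof
  show "relabel r ` cbox a b \<subseteq> cbox (relabel r a) (relabel r b)"
    by (auto simp: mem_box_cart relabel_def)
  show "cbox (relabel r a) (relabel r b) \<subseteq> relabel r ` cbox a b"
  proof
    fix y assume y: "y \<in> cbox (relabel r a) (relabel r b)"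
    have "relabel (inv r) y \<in> cbox a b"
    proof (unfold mem_box_cart, intro allI)
      fix j
      show "a $ j \<le> relabel (inv r) y $ j \<and> relabel (inv r) y $ j \<le> b $ j"
        using y[unfolded mem_box_cart, rule_format, of "inv r j"] assms
        by (simp add: relabel_def surj_f_inv_f bij_is_surj)
    qed
    then show "y \<in> relabel r ` cbox a b"
      using relabel_inv'[OF assms] by (metis image_eqI)
  qed
qed

lemma content_relabel_cbox:
  assumes "bij r"
  shows "measure lborel (relabel r ` cbox a b) = measure lborel (cbox a b)"
proof (cases "cbox a b = {}")
  case False
  have "(\<Prod>i\<in>UNIV. b $ r i - a $ r i) = (\<Prod>j\<in>UNIV. b $ j - a $ j)"
    using prod.reindex[of r UNIV "\<lambda>j. b $ j - a $ j"] assms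
    by (simp add: bij_is_inj bij_is_surj)
  moreover have "cbox (relabel r a) (relabel r b) \<noteq> {}"
    using False relabel_cbox[OF assms, of a b] by auto
  ultimately show ?thesis
    unfolding relabel_cbox[OF assms] using False
    by (simp add: content_cbox_cart) (simp add: relabel_def)
qed simp

lemma measure_relabel:
  assumes "bij r" "bounded S" "S \<in> lmeasurable"
  shows "relabel r ` S \<in> lmeasurable" "measure lebesgue (relabel r ` S) = measure lebesgue S"
proof -
  let ?g = "relabel (inv r)" and ?h = "relabel r"
  have inv: "bij (inv r)" using assms(1) by (rule bij_imp_bij_inv)
  obtain a where a: "S \<subseteq> cbox (- a) a"
    using bounded_subset_cbox_symmetric[OF assms(2)] by blast
  have "(indicator S has_integral measure lebesgue S) UNIV"
    using assms(3) by (simp add: lmeasurable_iff_has_integral)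
  moreover have "(\<lambda>x. if x \<in> cbox (- a) a then indicator S x else 0) = (indicator S :: _ \<Rightarrow> real)"
    using a by (auto simp: indicator_def fun_eq_iff)
  ultimately have "(indicator S has_integral measure lebesgue S) (cbox (- a) a)"
    by (metis has_integral_restrict_UNIV)
  then have "((\<lambda>x. indicator S (?g x)) has_integral (1 / 1) *\<^sub>R measure lebesgue S) (?h ` cbox (- a) a)"
    using relabel_cbox[OF inv] relabel_cbox[OF assms(1)] content_relabel_cbox[OF inv]
      relabel_inv[OF assms(1)] relabel_inv'[OF assms(1)]
    by (intro has_integral_twiddle) (auto intro: isCont_relabel)
  moreover have "(\<lambda>x. indicator S (?g x)) = (indicator (?h ` S) :: _ \<Rightarrow> real)"
    using relabel_inv[OF assms(1)] relabel_inv'[OF assms(1)]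
    by (auto simp: indicator_def image_iff fun_eq_iff)
  ultimately have "(indicator (?h ` S) has_integral measure lebesgue S) (?h ` cbox (- a) a)"
    by simp
  then have "((\<lambda>x. if x \<in> ?h ` cbox (- a) a then indicator (?h ` S) x else 0) has_integral
      measure lebesgue S) UNIV"
    by (simp only: has_integral_restrict_UNIV)
  moreover have "(\<lambda>x. if x \<in> ?h ` cbox (- a) a then indicator (?h ` S) x else 0)
      = (indicator (?h ` S) :: _ \<Rightarrow> real)"
    using a by (auto simp: indicator_def fun_eq_iff)
  ultimately have "(indicator (?h ` S) has_integral measure lebesgue S) UNIV"
    by simp
  then show "?h ` S \<in> lmeasurable" "measure lebesgue (?h ` S) = measure lebesgue S"
    using lmeasurable_iff_indicator_has_integral lmeasurable_iff_has_integral has_integral_unique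
    by blast+
qed

lemma det_relabel:
  fixes A :: "real^'n::finite^'n" and r :: "'m::finite \<Rightarrow> 'n"
  assumes "bij r"
  shows "det (\<chi> i j. A $ r i $ r j) = det A"
proof -
  define conj where "conj q = map_permutation UNIV r q" for q :: "'m \<Rightarrow> 'm"
  have conj: "conj q = r \<circ> q \<circ> inv r" for q
    using assms by (auto simp: conj_def map_permutation_def restrict_id_def bij_is_surj fun_eq_iff)
  have "det (\<chi> i j. A $ r i $ r j) = (\<Sum>q | q permutes (UNIV :: 'm set).
      of_int (sign q) * (\<Prod>i\<in>UNIV. A $ r i $ r (q i)))"
    by (simp add: det_def)
  also have "\<dots> = (\<Sum>p | p permutes (UNIV :: 'n set). of_int (sign p) * (\<Prod>j\<in>UNIV. A $ j $ p j))"
  proof (rule sum.reindex_bij_witness[where i = "\<lambda>p. inv r \<circ> p \<circ> r" and j = conj])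
    fix q :: "'m \<Rightarrow> 'm" assume q: "q \<in> {q. q permutes UNIV}"
    show "conj q \<in> {p. p permutes UNIV}"
      using map_permutation_permutes[of r UNIV UNIV q] q assms by (simp add: conj_def bij_betw_def)
    show "inv r \<circ> conj q \<circ> r = q"
      using assms by (simp add: conj fun_eq_iff bij_is_inj)
    have "sign (conj q) = sign q"
      using sign_map_permutation[of r UNIV q] q assms by (simp add: conj_def bij_is_inj)
    moreover have "(\<Prod>j\<in>UNIV. A $ j $ conj q j) = (\<Prod>i\<in>UNIV. A $ r i $ r (q i))"
      using prod.reindex[of r UNIV "\<lambda>j. A $ j $ conj q j"] assms
      by (simp add: conj bij_is_inj bij_is_surj)
    ultimately show "of_int (sign (conj q)) * (\<Prod>j\<in>UNIV. A $ j $ conj q j)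
        = of_int (sign q) * (\<Prod>i\<in>UNIV. A $ r i $ r (q i))"
      by simp
  next
    fix p :: "'n \<Rightarrow> 'n" assume p: "p \<in> {p. p permutes UNIV}"
    show "inv r \<circ> p \<circ> r \<in> {q. q permutes UNIV}"
      using p assms by (auto intro!: bij_imp_permutes bij_comp bij_imp_bij_inv simp: permutes_bij)
    show "conj (inv r \<circ> p \<circ> r) = p"
      using assms by (simp add: conj fun_eq_iff bij_is_surj surj_f_inv_f)
  qed
  also have "\<dots> = det A" by (simp add: det_def)
  finally show ?thesis .
qed

lemma measure_linear_image_finite:
  fixes f :: "real^'n::finite \<Rightarrow> real^'n"
  assumes "linear f" "bounded S" "S \<in> lmeasurable"
  shows "f ` S \<in> lmeasurable" "measure lebesgue (f ` S) = \<bar>det (matrix f)\<bar> * measure lebesgue S"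
proof -
  let ?r = "Rep_ordered :: 'n ordered \<Rightarrow> 'n"
  let ?P = "relabel ?r" and ?Q = "relabel (inv ?r)"
  have "bij ?r"
    using type_definition.Rep_range[OF type_definition_ordered]
    by (auto simp: bij_def inj_on_def Rep_ordered_inject)
  then have r: "bij ?r" "bij (inv ?r)"
    by (auto intro: bij_imp_bij_inv)
  define f' where "f' = ?P \<circ> f \<circ> ?Q"
  have "linear f'" unfolding f'_def
    using assms(1) by (intro linear_compose linear_relabel)
  have PS: "?P ` S \<in> lmeasurable" "bounded (?P ` S)" "measure lebesgue (?P ` S) = measure lebesgue S"
    using measure_relabel[OF r(1) assms(2,3)]
      bounded_linear_image[OF assms(2) linear_relabel[THEN linear_linear[THEN iffD2]]]
    by auto
  have f'PS: "f' ` ?P ` S \<in> lmeasurable" "bounded (f' ` ?P ` S)"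
    "measure lebesgue (f' ` ?P ` S) = \<bar>det (matrix f')\<bar> * measure lebesgue S"
    using measurable_linear_image[OF \<open>linear f'\<close> PS(1)] measure_linear_image[OF \<open>linear f'\<close> PS(1)]
      bounded_linear_image[OF PS(2)] \<open>linear f'\<close> PS(3)
    by (auto simp: linear_linear)
  have "f ` S = ?Q ` f' ` ?P ` S"
    using relabel_inv[OF r(1)] by (simp add: f'_def image_comp comp_def)
  moreover have "matrix f' = (\<chi> i j. matrix f $ ?r i $ ?r j)"
  proof -
    have "inv ?r k = j \<longleftrightarrow> k = ?r j" for k j
      using r(1) by (metis bij_inv_eq_iff)
    then have "?Q (axis j 1) = axis (?r j) 1" for j
      by (simp add: relabel_def axis_def vec_eq_iff)
    then show ?thesis
      by (simp add: matrix_def f'_def vec_eq_iff relabel_def)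
  qed
  ultimately show "f ` S \<in> lmeasurable" "measure lebesgue (f ` S) = \<bar>det (matrix f)\<bar> * measure lebesgue S"
    using measure_relabel[OF r(2) f'PS(2,1)] f'PS(3) det_relabel[OF r(1)] by simp_all
qed

section \<open>Ellipsoids and paraboloid caps\<close>

lemma measure_ball_scale:
  assumes "r \<ge> 0"
  shows "measure lebesgue (ball (0::real^'n::finite) r) = r ^ CARD('n) * unit_ball_volume TYPE('n)"
proof -
  have "emeasure lebesgue (ball (0::real^'n) r) = ennreal (r ^ CARD('n)) * emeasure lebesgue (ball (0::real^'n) 1)"
    using emeasure_lebesgue_ball_conv_unit_ball[OF assms, of "0::real^'n"] by simp
  then have "measure lebesgue (ball (0::real^'n) r) = r ^ CARD('n) * measure lebesgue (ball (0::real^'n) 1)"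
    unfolding measure_def using assms by (simp add: enn2real_mult)
  then show ?thesis by (simp add: unit_ball_volume_def)
qed

lemma continuous_on_quadratic_form:
  fixes H :: "real^'n::finite^'n"
  shows "continuous_on S (\<lambda>x. x \<bullet> (H *v x))"
  by (intro continuous_intros matrix_vector_mult_linear_continuous_on[THEN continuous_on_compose2[of UNIV]])
    auto

lemma det_congruent_identity:
  fixes H T :: "real^'n::finite^'n"
  assumes "transpose T ** H ** T = mat 1"
  shows "(det T)\<^sup>2 * det H = 1"
  using arg_cong[OF assms, of det] by (simp add: det_mul det_transpose power2_eq_square mult_ac)

locale pos_def_matrix =
  fixes H :: "real^'n::finite^'n"
  assumes symmetric: "transpose H = H"
    and pos_def: "\<And>x. x \<noteq> 0 \<Longrightarrow> 0 < x \<bullet> (H *v x)"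
begin

definition ellipsoid :: "real \<Rightarrow> (real^'n) set"
  where "ellipsoid r = {x. x \<bullet> (H *v x) < r}"

lemma bounded_ellipsoid: "bounded (ellipsoid r)"
proof -
  obtain c where c: "c > 0" "\<And>x. c * (norm x)\<^sup>2 \<le> x \<bullet> (H *v x)"
    using quadratic_form_coercive[OF pos_def] by blast
  have "norm x \<le> sqrt (\<bar>r\<bar> / c)" if "x \<in> ellipsoid r" for x
  proof -
    have "c * (norm x)\<^sup>2 \<le> \<bar>r\<bar>" using c(2)[of x] that by (auto simp: ellipsoid_def)
    then have "(norm x)\<^sup>2 \<le> \<bar>r\<bar> / c" using c(1) by (simp add: field_simps)
    then show ?thesis by (simp add: real_le_rsqrt)
  qed
  then show ?thesis unfolding bounded_iff by blast
qed

lemma open_ellipsoid: "open (ellipsoid r)"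
  unfolding ellipsoid_def
  by (rule open_Collect_less[OF continuous_on_quadratic_form continuous_on_const])

lemma lmeasurable_ellipsoid: "ellipsoid r \<in> lmeasurable"
  by (rule lmeasurable_open[OF bounded_ellipsoid open_ellipsoid])

lemma det_pos: "det H > 0"
proof -
  obtain T :: "real^'n^'n" where "transpose T ** H ** T = mat 1"
    using quadratic_form_congruent_identity[OF symmetric pos_def] by blast
  then have "0 < (det T)\<^sup>2 * det H"
    by (simp add: det_congruent_identity)
  then show ?thesis
    by (simp add: zero_less_mult_iff)
qed

lemma ellipsoid_eq_linear_image_ball:
  fixes T :: "real^'n^'n"
  assumes "transpose T ** H ** T = mat 1" "r \<ge> 0"
  shows "ellipsoid r = (*v) T ` ball 0 (sqrt r)"
proof -
  have Q: "(T *v x) \<bullet> (H *v (T *v x)) = (norm x)\<^sup>2" for x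
    using bilinear_form_congruence[of T x H x] assms(1) by (simp add: power2_norm_eq_inner)
  have "det T \<noteq> 0"
    using arg_cong[OF assms(1), of det] by (auto simp: det_mul)
  then have "inj ((*v) T)"
    using det_nz_iff_inj[OF matrix_vector_mul_linear[of T]] by (simp add: matrix_of_matrix_vector_mul)
  then have "surj ((*v) T)"
    by (rule linear_inj_imp_surj[OF matrix_vector_mul_linear])
  show ?thesis
  proof safe
    fix x assume "x \<in> ellipsoid r"
    moreover obtain y where "x = T *v y" using \<open>surj ((*v) T)\<close> by (metis surjD)
    ultimately have "(norm y)\<^sup>2 < r" by (simp add: ellipsoid_def Q)
    then have "norm y < sqrt r" using assms(2) real_less_rsqrt by blast
    with \<open>x = T *v y\<close> show "x \<in> (*v) T ` ball 0 (sqrt r)" by auto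
  next
    fix y :: "real^'n" assume "y \<in> ball 0 (sqrt r)"
    then have "(norm y)\<^sup>2 < (sqrt r)\<^sup>2"
      by (intro power_strict_mono) auto
    then have "(norm y)\<^sup>2 < r"
      using assms(2) by simp
    then show "T *v y \<in> ellipsoid r" by (simp add: ellipsoid_def Q)
  qed
qed

lemma measure_ellipsoid:
  assumes "r \<ge> 0"
  shows "measure lebesgue (ellipsoid r) = sqrt r ^ CARD('n) * unit_ball_volume TYPE('n) / sqrt (det H)"
proof -
  obtain T :: "real^'n^'n" where T: "transpose T ** H ** T = mat 1"
    using quadratic_form_congruent_identity[OF symmetric pos_def] by blast
  then have "(det T)\<^sup>2 = 1 / det H"
    using det_pos by (simp add: det_congruent_identity eq_divide_eq)
  then have "\<bar>det T\<bar> = 1 / sqrt (det H)"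
    by (simp flip: real_sqrt_abs add: real_sqrt_divide)
  have "measure lebesgue (ellipsoid r) = measure lebesgue ((*v) T ` ball 0 (sqrt r))"
    using ellipsoid_eq_linear_image_ball[OF T assms] by simp
  also have "\<dots> = \<bar>det T\<bar> * measure lebesgue (ball (0::real^'n) (sqrt r))"
    using measure_linear_image_finite(2)[OF matrix_vector_mul_linear[of T] bounded_ball lmeasurable_ball]
    by (simp add: matrix_of_matrix_vector_mul)
  finally show ?thesis
    using \<open>\<bar>det T\<bar> = 1 / sqrt (det H)\<close> measure_ball_scale[where 'n = 'n, of "sqrt r"] assms by simp
qed

definition paraboloid_cap :: "real \<Rightarrow> real^'n \<Rightarrow> real"
  where "paraboloid_cap r x = max 0 (r - x \<bullet> (H *v x))"

lemma paraboloid_cap_eq_0: "x \<notin> ellipsoid r \<Longrightarrow> paraboloid_cap r x = 0"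
  by (simp add: paraboloid_cap_def ellipsoid_def max_def)

lemma paraboloid_cap_integrable: "paraboloid_cap r integrable_on UNIV"
proof -
  obtain a where a: "ellipsoid r \<subseteq> cbox (- a) a"
    using bounded_subset_cbox_symmetric[OF bounded_ellipsoid] by blast
  have "continuous_on (cbox (- a) a) (paraboloid_cap r)"
    unfolding paraboloid_cap_def[abs_def] by (intro continuous_intros continuous_on_quadratic_form)
  then have "paraboloid_cap r integrable_on cbox (- a) a"
    by (rule integrable_continuous)
  moreover have "paraboloid_cap r x = 0" if "x \<notin> cbox (- a) a" for x
    using a that paraboloid_cap_eq_0 by blast
  ultimately show ?thesis
    by (rule integrable_on_superset) auto
qed

lemma integral_paraboloid_cap_scale:
  assumes "r > 0"
  shows "integral UNIV (paraboloid_cap r) = sqrt r ^ (CARD('n) + 2) * integral UNIV (paraboloid_cap 1)"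
proof -
  define m where "m = 1 / sqrt r"
  have "m > 0" using assms by (simp add: m_def)
  have cap: "paraboloid_cap r x = r * paraboloid_cap 1 (m *\<^sub>R x)" for x
    unfolding paraboloid_cap_def quadratic_form_scaleR using assms
    by (simp add: m_def power_divide max_def field_simps)
  obtain a where a: "ellipsoid 1 \<subseteq> cbox (- a) a"
    using bounded_subset_cbox_symmetric[OF bounded_ellipsoid] by blast
  have zero: "paraboloid_cap 1 x = 0" if "x \<notin> cbox (- a) a" for x
    using a that paraboloid_cap_eq_0 by blast
  have "(\<lambda>x. if x \<in> cbox (- a) a then paraboloid_cap 1 x else 0) = paraboloid_cap 1"
    using zero by auto
  then have "(paraboloid_cap 1 has_integral integral UNIV (paraboloid_cap 1)) (cbox (- a) a)"
    using paraboloid_cap_integrable[of 1] by (metis has_integral_restrict_UNIV integrable_integral)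
  from has_integral_affinity[OF this, of m 0] \<open>m > 0\<close>
  have "((\<lambda>x. paraboloid_cap 1 (m *\<^sub>R x)) has_integral sqrt r ^ CARD('n) * integral UNIV (paraboloid_cap 1))
      ((\<lambda>x. (1 / m) *\<^sub>R x) ` cbox (- a) a)"
    using assms by (simp add: m_def power_one_over)
  then have "((\<lambda>x. paraboloid_cap 1 (m *\<^sub>R x)) has_integral sqrt r ^ CARD('n) * integral UNIV (paraboloid_cap 1))
      UNIV"
  proof (rule has_integral_on_superset)
    fix x assume x: "x \<notin> (\<lambda>x. (1 / m) *\<^sub>R x) ` cbox (- a) a"
    have "x = (1 / m) *\<^sub>R (m *\<^sub>R x)" using \<open>m > 0\<close> by simp
    with x have "m *\<^sub>R x \<notin> cbox (- a) a" by blast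
    then show "paraboloid_cap 1 (m *\<^sub>R x) = 0" by (rule zero)
  qed simp
  then have "(paraboloid_cap r has_integral r * (sqrt r ^ CARD('n) * integral UNIV (paraboloid_cap 1))) UNIV"
    unfolding cap by (rule has_integral_mult_right)
  then show ?thesis
    using assms by (simp add: integral_unique power_add)
qed

lemma integral_paraboloid_cap_increment:
  assumes "0 \<le> r" "r < s"
  shows "(s - r) * measure lebesgue (ellipsoid r)
      \<le> integral UNIV (paraboloid_cap s) - integral UNIV (paraboloid_cap r)"
    and "integral UNIV (paraboloid_cap s) - integral UNIV (paraboloid_cap r)
      \<le> (s - r) * measure lebesgue (ellipsoid s)"
proof -
  have diff: "integral UNIV (paraboloid_cap s) - integral UNIV (paraboloid_cap r)
      = integral UNIV (\<lambda>x. paraboloid_cap s x - paraboloid_cap r x)"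
    by (simp add: integral_diff paraboloid_cap_integrable)
  have diff_int: "(\<lambda>x. paraboloid_cap s x - paraboloid_cap r x) integrable_on UNIV"
    by (simp add: integrable_diff paraboloid_cap_integrable)
  have ind: "(s - r) * measure lebesgue (ellipsoid t) = integral UNIV (\<lambda>x. (s - r) * indicator (ellipsoid t) x)"
    and ind_int: "(\<lambda>x. (s - r) * indicator (ellipsoid t) x) integrable_on UNIV" for t
  proof -
    have "(indicator (ellipsoid t) has_integral measure lebesgue (ellipsoid t)) UNIV"
      using lmeasurable_ellipsoid[of t] by (simp add: lmeasurable_iff_has_integral)
    then show "(s - r) * measure lebesgue (ellipsoid t) = integral UNIV (\<lambda>x. (s - r) * indicator (ellipsoid t) x)"
      and "(\<lambda>x. (s - r) * indicator (ellipsoid t) x) integrable_on UNIV"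
      by (auto simp: integral_unique intro: integrable_on_mult_right)
  qed
  show "(s - r) * measure lebesgue (ellipsoid r)
      \<le> integral UNIV (paraboloid_cap s) - integral UNIV (paraboloid_cap r)"
    unfolding diff ind using assms
    by (intro integral_le[OF ind_int diff_int])
      (auto simp: paraboloid_cap_def ellipsoid_def indicator_def max_def)
  show "integral UNIV (paraboloid_cap s) - integral UNIV (paraboloid_cap r)
      \<le> (s - r) * measure lebesgue (ellipsoid s)"
    unfolding diff ind using assms
    by (intro integral_le[OF diff_int ind_int])
      (auto simp: paraboloid_cap_def ellipsoid_def indicator_def max_def)
qed

lemma integral_paraboloid_cap_one:
  "integral UNIV (paraboloid_cap 1) = 2 * (unit_ball_volume TYPE('n) / sqrt (det H)) / (CARD('n) + 2)"
proof -
  define n where "n = CARD('n)"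
  define C where "C = unit_ball_volume TYPE('n) / sqrt (det H)"
  define G where "G = integral UNIV (paraboloid_cap 1)"
  define \<phi> where "\<phi> h = sqrt (1 + h) ^ (n + 2)" for h :: real
  \<comment> \<open>Scaling turns the increment bounds into bounds on the difference quotient of \<open>\<phi>\<close> at \<open>0\<close>.\<close>
  have bounds: "C \<le> (\<phi> h - 1) / h * G \<and> (\<phi> h - 1) / h * G \<le> sqrt (1 + h) ^ n * C" if "h > 0" for h
  proof -
    have "integral UNIV (paraboloid_cap (1 + h)) = \<phi> h * G"
      using integral_paraboloid_cap_scale[of "1 + h"] that by (simp add: \<phi>_def G_def n_def)
    then show ?thesis
      using integral_paraboloid_cap_increment[of 1 "1 + h"] measure_ellipsoid[of 1]
        measure_ellipsoid[of "1 + h"] that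
      by (simp add: G_def C_def n_def field_simps)
  qed
  have "(\<phi> has_real_derivative (real n + 2) / 2) (at 0)"
    unfolding \<phi>_def[abs_def] by (auto intro!: derivative_eq_intros simp: field_simps)
  then have "((\<lambda>h. (\<phi> h - 1) / h) \<longlongrightarrow> (real n + 2) / 2) (at_right 0)"
    by (simp add: DERIV_def \<phi>_def tendsto_mono[OF at_le[OF subset_UNIV]])
  then have lim: "((\<lambda>h. (\<phi> h - 1) / h * G) \<longlongrightarrow> (real n + 2) / 2 * G) (at_right 0)"
    by (intro tendsto_mult tendsto_const)
  have "((\<lambda>h. sqrt (1 + h) ^ n * C) \<longlongrightarrow> C) (at_right 0)"
    by (auto intro!: tendsto_eq_intros)
  moreover have "\<forall>\<^sub>F h in at_right 0. C \<le> (\<phi> h - 1) / h * G"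
    and "\<forall>\<^sub>F h in at_right 0. (\<phi> h - 1) / h * G \<le> sqrt (1 + h) ^ n * C"
    using bounds eventually_at_right_less[of 0] by (auto elim: eventually_mono)
  ultimately have "C \<le> (real n + 2) / 2 * G" "(real n + 2) / 2 * G \<le> C"
    using tendsto_le[OF trivial_limit_at_right_real lim tendsto_const]
      tendsto_le[OF trivial_limit_at_right_real _ lim] by blast+
  then have "G = 2 * C / (real n + 2)"
    by (simp add: field_simps)
  then show ?thesis
    by (simp add: G_def C_def n_def)
qed

lemma eventually_ellipsoid_subset_ball:
  assumes "c > 0" "\<rho> > 0"
  shows "\<forall>\<^sub>F t in at_right 0. ellipsoid (c * t) \<subseteq> ball 0 \<rho>"
proof -
  obtain k where k: "k > 0" "\<And>x. k * (norm x)\<^sup>2 \<le> x \<bullet> (H *v x)"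
    using quadratic_form_coercive[OF pos_def] by blast
  have "ellipsoid (c * t) \<subseteq> ball 0 \<rho>" if "0 < t" "t < k * \<rho>\<^sup>2 / c" for t
  proof
    fix x assume "x \<in> ellipsoid (c * t)"
    then have "k * (norm x)\<^sup>2 < k * \<rho>\<^sup>2"
      using k(2)[of x] that assms(1) by (simp add: ellipsoid_def field_simps)
    then have "norm x < \<rho>"
      using k(1) assms(2) by (simp add: power_less_imp_less_base)
    then show "x \<in> ball 0 \<rho>" by simp
  qed
  moreover have "k * \<rho>\<^sup>2 / c > 0" using k(1) assms by simp
  ultimately show ?thesis
    unfolding eventually_at_right_field by blast
qed

lemma measure_ellipsoid_scaled:
  assumes "c > 0" "t > 0"
  shows "measure lebesgue (ellipsoid (c * t)) / sqrt t ^ CARD('n)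
    = sqrt c ^ CARD('n) * (unit_ball_volume TYPE('n) / sqrt (det H))"
  using assms measure_ellipsoid[of "c * t"] by (simp add: real_sqrt_mult power_mult_distrib)

lemma integral_paraboloid_cap_scaled:
  assumes "c > 0" "t > 0"
  shows "integral UNIV (paraboloid_cap (c * t)) / sqrt t ^ (CARD('n) + 2)
    = sqrt c ^ (CARD('n) + 2) * integral UNIV (paraboloid_cap 1)"
  using assms integral_paraboloid_cap_scale[of "c * t"] by (simp add: real_sqrt_mult power_mult_distrib)

end

section \<open>Sublevel sets of a convex graph\<close>

lemma tendsto_sandwich_param:
  fixes F lo hi :: "real \<Rightarrow> real"
  assumes bounds: "\<And>\<eta>. 0 < \<eta> \<Longrightarrow> \<eta> < 1 \<Longrightarrow> \<forall>\<^sub>F t in at_right 0. lo \<eta> \<le> F t \<and> F t \<le> hi \<eta>"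
    and lo: "(lo \<longlongrightarrow> L) (at_right 0)" and hi: "(hi \<longlongrightarrow> L) (at_right 0)"
  shows "(F \<longlongrightarrow> L) (at_right 0)"
proof (rule tendstoI)
  fix e :: real assume "e > 0"
  have "\<forall>\<^sub>F \<eta> in at_right 0. \<eta> < (1::real)"
    unfolding eventually_at_right_field by (intro exI[of _ 1]) auto
  then have "\<forall>\<^sub>F \<eta> in at_right 0. (0 < \<eta> \<and> \<eta> < 1) \<and> dist (lo \<eta>) L < e \<and> dist (hi \<eta>) L < e"
    using eventually_at_right_less[of 0] tendstoD[OF lo \<open>e > 0\<close>] tendstoD[OF hi \<open>e > 0\<close>]
    by (intro eventually_conj) auto
  then obtain \<eta> where "0 < \<eta>" "\<eta> < 1" "dist (lo \<eta>) L < e" "dist (hi \<eta>) L < e"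
    using eventually_happens'[OF trivial_limit_at_right_real] by blast
  with bounds[of \<eta>] show "\<forall>\<^sub>F t in at_right 0. dist (F t) L < e"
    by (auto elim: eventually_mono simp: dist_real_def)
qed

lemma integrable_on_bounded_continuous:
  fixes g :: "real^'n::finite \<Rightarrow> real"
  assumes "continuous_on S g" "S \<in> lmeasurable" "\<And>x. x \<in> S \<Longrightarrow> \<bar>g x\<bar> \<le> C"
  shows "g integrable_on S"
proof -
  have "g absolutely_integrable_on S"
    using assms fmeasurableD[OF assms(2)]
    by (intro measurable_bounded_by_integrable_imp_absolutely_integrable[where g = "\<lambda>x. C"])
      (auto simp: continuous_imp_measurable_on_sets_lebesgue integrable_on_const)
  then show ?thesis by (simp add: absolutely_integrable_on_def)
qed

locale convex_graph =
  fixes U :: "(real^'n::finite) set" and f :: "real^'n \<Rightarrow> real"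
  assumes open_U: "open U" and convex_U: "convex U" and zero_in_U: "0 \<in> U"
    and smooth: "smooth_on U f" and convex: "convex_on U f"
    and nonneg: "\<And>x. x \<in> U \<Longrightarrow> 0 \<le> f x" and f_zero: "f 0 = 0"
    and grad_zero: "grad f 0 = 0" and det_hessian_pos: "det (hessian f 0) > 0"
begin

lemma quadratic_expansion:
  "\<epsilon> > 0 \<Longrightarrow> \<forall>\<^sub>F h in nhds 0. \<bar>f h - h \<bullet> (hessian f 0 *v h) / 2\<bar> \<le> \<epsilon> * (norm h)\<^sup>2"
  using smooth_quadratic_expansion[OF open_U zero_in_U smooth grad_zero] f_zero by simp

lemma hessian_pos_def: "x \<noteq> 0 \<Longrightarrow> 0 < x \<bullet> (hessian f 0 *v x)"
proof (rule quadratic_form_pos_def[OF hessian_symmetric[OF open_U zero_in_U smooth]])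
  have "\<forall>\<^sub>F h in nhds (0::real^'n). h \<in> U"
    using open_U zero_in_U by (rule eventually_nhds_in_open)
  then have "\<forall>\<^sub>F h in nhds 0. f 0 \<le> f h"
    by (auto elim: eventually_mono simp: f_zero nonneg)
  with quadratic_expansion show "0 \<le> v \<bullet> (hessian f 0 *v v)" for v
    using local_min_quadratic_form_nonneg[where H = "hessian f 0" and f = f] f_zero by simp
qed (use det_hessian_pos in auto)

sublocale pos_def_matrix "hessian f 0"
  using hessian_symmetric[OF open_U zero_in_U smooth] hessian_pos_def by unfold_locales

definition sublevel :: "real \<Rightarrow> (real^'n) set"
  where "sublevel t = {x \<in> U. f x < t}"

lemma continuous_on_f: "continuous_on U f"
  using smooth_on_isCont[OF smooth open_U, of _ "[]"] by (simp add: continuous_at_imp_continuous_on)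

lemma lmeasurable_sublevel: "bounded (sublevel t) \<Longrightarrow> sublevel t \<in> lmeasurable"
proof (rule lmeasurable_open)
  have "sublevel t = U \<inter> f -` {..<t}" by (auto simp: sublevel_def)
  then show "open (sublevel t)"
    using continuous_open_preimage[OF continuous_on_f open_U open_lessThan] by simp
qed

lemma quadratic_sandwich:
  assumes "\<eta> > 0"
  obtains \<delta> where "\<delta> > 0" "ball 0 \<delta> \<subseteq> U"
    "\<And>x. x \<in> ball 0 \<delta> \<Longrightarrow> (1 - \<eta>) * (x \<bullet> (hessian f 0 *v x)) / 2 \<le> f x
      \<and> f x \<le> (1 + \<eta>) * (x \<bullet> (hessian f 0 *v x)) / 2"
proof -
  obtain c where c: "c > 0" "\<And>x. c * (norm x)\<^sup>2 \<le> x \<bullet> (hessian f 0 *v x)"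
    using quadratic_form_coercive[OF pos_def] by blast
  have "\<forall>\<^sub>F x in nhds (0::real^'n).
      \<bar>f x - x \<bullet> (hessian f 0 *v x) / 2\<bar> \<le> \<eta> * c / 2 * (norm x)\<^sup>2 \<and> x \<in> U"
    using quadratic_expansion[of "\<eta> * c / 2"] assms c(1) eventually_nhds_in_open[OF open_U zero_in_U]
    by (auto intro: eventually_conj)
  then obtain \<delta> where "\<delta> > 0"
    and \<delta>: "\<And>x. norm x < \<delta> \<Longrightarrow> \<bar>f x - x \<bullet> (hessian f 0 *v x) / 2\<bar> \<le> \<eta> * c / 2 * (norm x)\<^sup>2 \<and> x \<in> U"
    by (auto simp: eventually_nhds_metric dist_norm)
  show ?thesis
  proof (rule that[OF \<open>\<delta> > 0\<close>])
    show "ball 0 \<delta> \<subseteq> U" using \<delta> by auto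
    fix x :: "real^'n" assume "x \<in> ball 0 \<delta>"
    then have "\<bar>f x - x \<bullet> (hessian f 0 *v x) / 2\<bar> \<le> \<eta> * c / 2 * (norm x)\<^sup>2"
      using \<delta> by simp
    moreover have "\<eta> * c / 2 * (norm x)\<^sup>2 \<le> \<eta> / 2 * (x \<bullet> (hessian f 0 *v x))"
      using c(2)[of x] assms by (simp add: mult_left_mono)
    ultimately show "(1 - \<eta>) * (x \<bullet> (hessian f 0 *v x)) / 2 \<le> f x
      \<and> f x \<le> (1 + \<eta>) * (x \<bullet> (hessian f 0 *v x)) / 2"
      unfolding abs_le_iff by (simp add: algebra_simps)
  qed
qed

text \<open>A convex function vanishing at \<open>0\<close> that is bounded below by a positive constant on a small
  sphere is bounded below by that constant outside the sphere.\<close>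
lemma eventually_sublevel_subset_ball:
  assumes "\<rho> > 0"
  shows "\<forall>\<^sub>F t in at_right 0. sublevel t \<subseteq> ball 0 \<rho>"
proof -
  have "(0::real) < 1 / 2" by simp
  then obtain \<delta> where \<delta>: "\<delta> > 0" "ball 0 \<delta> \<subseteq> U"
    "\<And>x. x \<in> ball 0 \<delta> \<Longrightarrow> (1 - 1 / 2) * (x \<bullet> (hessian f 0 *v x)) / 2 \<le> f x
      \<and> f x \<le> (1 + 1 / 2) * (x \<bullet> (hessian f 0 *v x)) / 2"
    by (rule quadratic_sandwich) blast
  obtain c where c: "c > 0" "\<And>x. c * (norm x)\<^sup>2 \<le> x \<bullet> (hessian f 0 *v x)"
    using quadratic_form_coercive[OF pos_def] by blast
  define r where "r = min \<rho> \<delta>"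
  define t0 where "t0 = c * (r / 2)\<^sup>2 / 4"
  have "r > 0" "r \<le> \<delta>" "t0 > 0" using assms \<delta>(1) c(1) by (auto simp: r_def t0_def)
  have "norm x < r" if "x \<in> sublevel t" "t < t0" for x t
  proof (rule ccontr)
    assume "\<not> norm x < r"
    define \<theta> where "\<theta> = r / (2 * norm x)"
    have "norm x > 0" "r \<le> norm x" using \<open>\<not> norm x < r\<close> \<open>r > 0\<close> by auto
    then have "0 \<le> \<theta>" "\<theta> \<le> 1" "norm (\<theta> *\<^sub>R x) = r / 2"
      using \<open>r > 0\<close> by (auto simp: \<theta>_def pos_divide_le_eq)
    have "x \<in> U" "f x < t" using that by (auto simp: sublevel_def)
    have "f (\<theta> *\<^sub>R x) = f ((1 - \<theta>) *\<^sub>R 0 + \<theta> *\<^sub>R x)" by simp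
    also have "\<dots> \<le> (1 - \<theta>) * f 0 + \<theta> * f x"
      using convex_onD[OF convex \<open>0 \<le> \<theta>\<close> \<open>\<theta> \<le> 1\<close> zero_in_U \<open>x \<in> U\<close>] by simp
    also have "\<dots> \<le> f x"
      using \<open>\<theta> \<le> 1\<close> nonneg[OF \<open>x \<in> U\<close>] by (simp add: f_zero mult_left_le_one_le \<open>0 \<le> \<theta>\<close>)
    finally have "f (\<theta> *\<^sub>R x) < t0" using \<open>f x < t\<close> \<open>t < t0\<close> by linarith
    moreover have "\<theta> *\<^sub>R x \<in> ball 0 \<delta>"
      using \<open>norm (\<theta> *\<^sub>R x) = r / 2\<close> \<open>r > 0\<close> \<open>r \<le> \<delta>\<close> by simp
    then have "c * (r / 2)\<^sup>2 / 4 \<le> f (\<theta> *\<^sub>R x)"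
      using \<delta>(3) c(2)[of "\<theta> *\<^sub>R x"] \<open>norm (\<theta> *\<^sub>R x) = r / 2\<close> by fastforce
    ultimately show False by (simp add: t0_def)
  qed
  then have "\<forall>t. 0 < t \<and> t < t0 \<longrightarrow> sublevel t \<subseteq> ball 0 \<rho>"
    by (fastforce simp: r_def)
  with \<open>t0 > 0\<close> show ?thesis
    unfolding eventually_at_right_field by blast
qed

lemma sublevel_between_ellipsoids:
  assumes "0 < \<eta>" "\<eta> < 1"
  shows "\<forall>\<^sub>F t in at_right 0. ellipsoid (2 / (1 + \<eta>) * t) \<subseteq> sublevel t
    \<and> sublevel t \<subseteq> ellipsoid (2 / (1 - \<eta>) * t)
    \<and> (\<forall>x\<in>ellipsoid (2 / (1 + \<eta>) * t). f x \<le> (1 + \<eta>) * (x \<bullet> (hessian f 0 *v x)) / 2)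
    \<and> (\<forall>x\<in>sublevel t. (1 - \<eta>) * (x \<bullet> (hessian f 0 *v x)) / 2 \<le> f x)"
proof -
  obtain \<delta> where \<delta>: "\<delta> > 0" "ball 0 \<delta> \<subseteq> U"
    "\<And>x. x \<in> ball 0 \<delta> \<Longrightarrow> (1 - \<eta>) * (x \<bullet> (hessian f 0 *v x)) / 2 \<le> f x
      \<and> f x \<le> (1 + \<eta>) * (x \<bullet> (hessian f 0 *v x)) / 2"
    using quadratic_sandwich[OF assms(1)] by blast
  have "\<forall>\<^sub>F t in at_right 0. ellipsoid (2 / (1 + \<eta>) * t) \<subseteq> ball 0 \<delta> \<and> sublevel t \<subseteq> ball 0 \<delta> \<and> 0 < t"
    using eventually_ellipsoid_subset_ball[of "2 / (1 + \<eta>)" \<delta>] eventually_sublevel_subset_ball[OF \<delta>(1)]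
      eventually_at_right_less[of 0] assms \<delta>(1)
    by (auto intro: eventually_conj)
  then show ?thesis
  proof (rule eventually_mono, safe)
    fix t x assume t: "ellipsoid (2 / (1 + \<eta>) * t) \<subseteq> ball 0 \<delta>" "sublevel t \<subseteq> ball 0 \<delta>" "0 < t"
    {
      assume "x \<in> ellipsoid (2 / (1 + \<eta>) * t)"
      with t(1) \<delta>(3) have "x \<in> U" "f x \<le> (1 + \<eta>) * (x \<bullet> (hessian f 0 *v x)) / 2"
        using \<delta>(2) by auto
      moreover have "(1 + \<eta>) * (x \<bullet> (hessian f 0 *v x)) / 2 < t"
        using \<open>x \<in> ellipsoid _\<close> assms by (simp add: ellipsoid_def field_simps)
      ultimately show "x \<in> sublevel t" "f x \<le> (1 + \<eta>) * (x \<bullet> (hessian f 0 *v x)) / 2"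
        by (auto simp: sublevel_def)
    }
    assume "x \<in> sublevel t"
    with t(2) \<delta>(3) show lower: "(1 - \<eta>) * (x \<bullet> (hessian f 0 *v x)) / 2 \<le> f x" by auto
    with \<open>x \<in> sublevel t\<close> show "x \<in> ellipsoid (2 / (1 - \<eta>) * t)"
      using assms by (auto simp: sublevel_def ellipsoid_def field_simps)
  qed
qed

lemma eventually_measure_sublevel_bounds:
  assumes "0 < \<eta>" "\<eta> < 1"
  shows "\<forall>\<^sub>F t in at_right 0. sublevel t \<in> lmeasurable
    \<and> sqrt (2 / (1 + \<eta>)) ^ CARD('n) * (unit_ball_volume TYPE('n) / sqrt (det (hessian f 0)))
        \<le> measure lebesgue (sublevel t) / sqrt t ^ CARD('n)
    \<and> measure lebesgue (sublevel t) / sqrt t ^ CARD('n)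
        \<le> sqrt (2 / (1 - \<eta>)) ^ CARD('n) * (unit_ball_volume TYPE('n) / sqrt (det (hessian f 0)))"
  using sublevel_between_ellipsoids[OF assms] eventually_at_right_less[of 0]
proof (elim eventually_elim2, safe)
  fix t :: real assume t: "0 < t"
    and sub: "ellipsoid (2 / (1 + \<eta>) * t) \<subseteq> sublevel t" "sublevel t \<subseteq> ellipsoid (2 / (1 - \<eta>) * t)"
  show lm: "sublevel t \<in> lmeasurable"
    using sub(2) bounded_ellipsoid by (intro lmeasurable_sublevel) (rule bounded_subset)
  have "measure lebesgue (ellipsoid (2 / (1 + \<eta>) * t)) \<le> measure lebesgue (sublevel t)"
    "measure lebesgue (sublevel t) \<le> measure lebesgue (ellipsoid (2 / (1 - \<eta>) * t))"
    using sub lm lmeasurable_ellipsoid by (auto intro: measure_mono_fmeasurable fmeasurableD)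
  then have "measure lebesgue (ellipsoid (2 / (1 + \<eta>) * t)) / sqrt t ^ CARD('n)
      \<le> measure lebesgue (sublevel t) / sqrt t ^ CARD('n)"
    "measure lebesgue (sublevel t) / sqrt t ^ CARD('n)
      \<le> measure lebesgue (ellipsoid (2 / (1 - \<eta>) * t)) / sqrt t ^ CARD('n)"
    using t by (auto intro!: divide_right_mono)
  then show "sqrt (2 / (1 + \<eta>)) ^ CARD('n) * (unit_ball_volume TYPE('n) / sqrt (det (hessian f 0)))
        \<le> measure lebesgue (sublevel t) / sqrt t ^ CARD('n)"
    "measure lebesgue (sublevel t) / sqrt t ^ CARD('n)
        \<le> sqrt (2 / (1 - \<eta>)) ^ CARD('n) * (unit_ball_volume TYPE('n) / sqrt (det (hessian f 0)))"
    using measure_ellipsoid_scaled[of "2 / (1 + \<eta>)" t] measure_ellipsoid_scaled[of "2 / (1 - \<eta>)" t]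
      assms t by simp_all
qed

lemma area_limit:
  "((\<lambda>t. integral (sublevel t) (\<lambda>x. 1) / sqrt t ^ CARD('n))
    \<longlongrightarrow> sqrt 2 ^ CARD('n) * unit_ball_volume TYPE('n) / sqrt (det (hessian f 0))) (at_right 0)"
proof (rule tendsto_sandwich_param)
  fix \<eta> :: real assume "0 < \<eta>" "\<eta> < 1"
  from eventually_measure_sublevel_bounds[OF this]
  show "\<forall>\<^sub>F t in at_right 0.
      sqrt (2 / (1 + \<eta>)) ^ CARD('n) * (unit_ball_volume TYPE('n) / sqrt (det (hessian f 0)))
        \<le> integral (sublevel t) (\<lambda>x. 1) / sqrt t ^ CARD('n)
    \<and> integral (sublevel t) (\<lambda>x. 1) / sqrt t ^ CARD('n)
        \<le> sqrt (2 / (1 - \<eta>)) ^ CARD('n) * (unit_ball_volume TYPE('n) / sqrt (det (hessian f 0)))"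
    by (elim eventually_mono) (metis lmeasure_integral)
qed (use det_hessian_pos in \<open>auto intro!: tendsto_eq_intros\<close>)

lemma area_element_bounds:
  assumes "\<eta> > 0"
  obtains \<rho> where "\<rho> > 0"
    "\<And>x. norm x < \<rho> \<Longrightarrow> 1 \<le> sqrt (1 + (norm (grad f x))\<^sup>2) \<and> sqrt (1 + (norm (grad f x))\<^sup>2) \<le> 1 + \<eta>"
proof -
  have "continuous_on U (dpart [i] f)" for i
    using smooth unfolding smooth_on_def by blast
  then have "continuous_on U (grad f)"
    unfolding grad_def by (intro continuous_on_vec_lambda)
  then have "isCont (grad f) 0"
    using open_U zero_in_U continuous_on_eq_continuous_at by blast
  then obtain \<rho> where "\<rho> > 0" and \<rho>: "\<And>x. norm x < \<rho> \<Longrightarrow> norm (grad f x) < \<eta>"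
    using assms grad_zero by (force simp: continuous_at_eps_delta dist_norm)
  have "sqrt (1 + (norm (grad f x))\<^sup>2) \<le> sqrt ((1 + norm (grad f x))\<^sup>2)" for x
    by (rule real_sqrt_le_mono) (simp add: power2_eq_square algebra_simps)
  then have "sqrt (1 + (norm (grad f x))\<^sup>2) \<le> 1 + norm (grad f x)" for x
    by simp
  with \<rho> show ?thesis
    by (intro that[OF \<open>\<rho> > 0\<close>]) (smt (verit) real_sqrt_ge_1_iff zero_le_power2)
qed

lemma eventually_surface_sublevel_bounds:
  assumes "\<eta> > 0"
  shows "\<forall>\<^sub>F t in at_right 0.
    measure lebesgue (sublevel t) \<le> integral (sublevel t) (\<lambda>x. sqrt (1 + (norm (grad f x))\<^sup>2))
    \<and> integral (sublevel t) (\<lambda>x. sqrt (1 + (norm (grad f x))\<^sup>2)) \<le> (1 + \<eta>) * measure lebesgue (sublevel t)"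
proof -
  obtain \<rho> where "\<rho> > 0" and element:
    "\<And>x. norm x < \<rho> \<Longrightarrow> 1 \<le> sqrt (1 + (norm (grad f x))\<^sup>2) \<and> sqrt (1 + (norm (grad f x))\<^sup>2) \<le> 1 + \<eta>"
    using area_element_bounds[OF assms] by blast
  have "continuous_on U (dpart [i] f)" for i
    using smooth unfolding smooth_on_def by blast
  then have cont: "continuous_on U (\<lambda>x. sqrt (1 + (norm (grad f x))\<^sup>2))"
    unfolding grad_def by (intro continuous_intros continuous_on_vec_lambda)
  show ?thesis
    using eventually_sublevel_subset_ball[OF \<open>\<rho> > 0\<close>]
  proof (rule eventually_mono)
    fix t assume sub: "sublevel t \<subseteq> ball 0 \<rho>"
    then have lm: "sublevel t \<in> lmeasurable"
      by (intro lmeasurable_sublevel) (rule bounded_subset[OF bounded_ball])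
    let ?S = "integral (sublevel t) (\<lambda>x. sqrt (1 + (norm (grad f x))\<^sup>2))"
    have bounds: "1 \<le> sqrt (1 + (norm (grad f x))\<^sup>2)" "sqrt (1 + (norm (grad f x))\<^sup>2) \<le> 1 + \<eta>"
      if "x \<in> sublevel t" for x
      using element sub that by auto
    have int: "(\<lambda>x. sqrt (1 + (norm (grad f x))\<^sup>2)) integrable_on sublevel t"
      using bounds assms
      by (intro integrable_on_bounded_continuous[OF continuous_on_subset[OF cont] lm, where C = "1 + \<eta>"])
        (auto simp: sublevel_def)
    have "measure lebesgue (sublevel t) \<le> ?S"
      unfolding lmeasure_integral[OF lm]
      by (rule integral_le[OF integrable_on_const[OF lm] int]) (use bounds in auto)
    moreover have "?S \<le> integral (sublevel t) (\<lambda>x. (1 + \<eta>) * 1)"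
      by (rule integral_le[OF int integrable_on_mult_right[OF integrable_on_const[OF lm]]])
        (use bounds in auto)
    then have "?S \<le> (1 + \<eta>) * measure lebesgue (sublevel t)"
      unfolding integral_mult_right lmeasure_integral[OF lm] .
    ultimately show "measure lebesgue (sublevel t) \<le> ?S \<and> ?S \<le> (1 + \<eta>) * measure lebesgue (sublevel t)"
      by blast
  qed
qed

lemma surface_limit:
  "((\<lambda>t. integral (sublevel t) (\<lambda>x. sqrt (1 + (norm (grad f x))\<^sup>2)) / sqrt t ^ CARD('n))
    \<longlongrightarrow> sqrt 2 ^ CARD('n) * unit_ball_volume TYPE('n) / sqrt (det (hessian f 0))) (at_right 0)"
proof (rule tendsto_sandwich_param)
  fix \<eta> :: real assume \<eta>: "0 < \<eta>" "\<eta> < 1"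
  define C where "C = unit_ball_volume TYPE('n) / sqrt (det (hessian f 0))"
  have "\<forall>\<^sub>F t in at_right 0. 0 < t \<and> (sublevel t \<in> lmeasurable
      \<and> sqrt (2 / (1 + \<eta>)) ^ CARD('n) * C \<le> measure lebesgue (sublevel t) / sqrt t ^ CARD('n)
      \<and> measure lebesgue (sublevel t) / sqrt t ^ CARD('n) \<le> sqrt (2 / (1 - \<eta>)) ^ CARD('n) * C)
    \<and> (measure lebesgue (sublevel t) \<le> integral (sublevel t) (\<lambda>x. sqrt (1 + (norm (grad f x))\<^sup>2))
      \<and> integral (sublevel t) (\<lambda>x. sqrt (1 + (norm (grad f x))\<^sup>2)) \<le> (1 + \<eta>) * measure lebesgue (sublevel t))"
    unfolding C_def
    by (rule eventually_conj[OF eventually_at_right_less eventually_conj[OF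
          eventually_measure_sublevel_bounds[OF \<eta>] eventually_surface_sublevel_bounds[OF \<eta>(1)]]])
  then show "\<forall>\<^sub>F t in at_right 0.
      sqrt (2 / (1 + \<eta>)) ^ CARD('n) * C
        \<le> integral (sublevel t) (\<lambda>x. sqrt (1 + (norm (grad f x))\<^sup>2)) / sqrt t ^ CARD('n)
    \<and> integral (sublevel t) (\<lambda>x. sqrt (1 + (norm (grad f x))\<^sup>2)) / sqrt t ^ CARD('n)
        \<le> (1 + \<eta>) * (sqrt (2 / (1 - \<eta>)) ^ CARD('n) * C)"
  proof (rule eventually_mono, safe)
    fix t :: real
    let ?A = "measure lebesgue (sublevel t) / sqrt t ^ CARD('n)"
    let ?S = "integral (sublevel t) (\<lambda>x. sqrt (1 + (norm (grad f x))\<^sup>2)) / sqrt t ^ CARD('n)"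
    assume "0 < t" and lo: "sqrt (2 / (1 + \<eta>)) ^ CARD('n) * C \<le> ?A"
      and hi: "?A \<le> sqrt (2 / (1 - \<eta>)) ^ CARD('n) * C"
      and "measure lebesgue (sublevel t) \<le> integral (sublevel t) (\<lambda>x. sqrt (1 + (norm (grad f x))\<^sup>2))"
      and "integral (sublevel t) (\<lambda>x. sqrt (1 + (norm (grad f x))\<^sup>2)) \<le> (1 + \<eta>) * measure lebesgue (sublevel t)"
    then have "?A \<le> ?S" "?S \<le> (1 + \<eta>) * ?A"
      by (simp_all add: divide_right_mono)
    moreover have "(1 + \<eta>) * ?A \<le> (1 + \<eta>) * (sqrt (2 / (1 - \<eta>)) ^ CARD('n) * C)"
      using hi \<eta> by (intro mult_left_mono) auto
    ultimately show "sqrt (2 / (1 + \<eta>)) ^ CARD('n) * C \<le> ?S"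
      "?S \<le> (1 + \<eta>) * (sqrt (2 / (1 - \<eta>)) ^ CARD('n) * C)"
      using lo by linarith+
  qed
qed (use det_hessian_pos in \<open>auto intro!: tendsto_eq_intros\<close>)

lemma sublevel_integrand_between_caps:
  assumes "0 < \<eta>" "\<eta> < 1"
    and sub: "ellipsoid (2 / (1 + \<eta>) * t) \<subseteq> sublevel t"
    and upper: "\<forall>x\<in>ellipsoid (2 / (1 + \<eta>) * t). f x \<le> (1 + \<eta>) * (x \<bullet> (hessian f 0 *v x)) / 2"
    and lower: "\<forall>x\<in>sublevel t. (1 - \<eta>) * (x \<bullet> (hessian f 0 *v x)) / 2 \<le> f x"
  shows "(1 + \<eta>) / 2 * paraboloid_cap (2 / (1 + \<eta>) * t) x \<le> (if x \<in> sublevel t then t - f x else 0)"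
    and "(if x \<in> sublevel t then t - f x else 0) \<le> (1 - \<eta>) / 2 * paraboloid_cap (2 / (1 - \<eta>) * t) x"
proof -
  show "(1 + \<eta>) / 2 * paraboloid_cap (2 / (1 + \<eta>) * t) x \<le> (if x \<in> sublevel t then t - f x else 0)"
  proof (cases "x \<in> ellipsoid (2 / (1 + \<eta>) * t)")
    case True
    then have "(1 + \<eta>) / 2 * paraboloid_cap (2 / (1 + \<eta>) * t) x
        = t - (1 + \<eta>) * (x \<bullet> (hessian f 0 *v x)) / 2"
      using assms(1,2) by (simp add: paraboloid_cap_def ellipsoid_def field_simps)
    with True sub upper show ?thesis by auto
  next
    case False
    then show ?thesis by (simp add: paraboloid_cap_eq_0 sublevel_def)
  qed
  show "(if x \<in> sublevel t then t - f x else 0) \<le> (1 - \<eta>) / 2 * paraboloid_cap (2 / (1 - \<eta>) * t) x"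
  proof (cases "x \<in> sublevel t")
    case True
    have "(1 - \<eta>) / 2 * (2 / (1 - \<eta>) * t - x \<bullet> (hessian f 0 *v x))
        = t - (1 - \<eta>) * (x \<bullet> (hessian f 0 *v x)) / 2"
      using assms(1,2) by (simp add: field_simps)
    then have "t - f x \<le> (1 - \<eta>) / 2 * (2 / (1 - \<eta>) * t - x \<bullet> (hessian f 0 *v x))"
      using lower True by auto
    also have "\<dots> \<le> (1 - \<eta>) / 2 * paraboloid_cap (2 / (1 - \<eta>) * t) x"
      using assms(1,2) by (intro mult_left_mono) (auto simp: paraboloid_cap_def)
    finally show ?thesis using True by simp
  next
    case False
    with assms(1,2) show ?thesis by (simp add: paraboloid_cap_def)
  qed
qed

lemma eventually_volume_sublevel_bounds:
  assumes \<eta>: "0 < \<eta>" "\<eta> < 1"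
  defines "G \<equiv> integral UNIV (paraboloid_cap 1)"
  shows "\<forall>\<^sub>F t in at_right 0.
    (1 + \<eta>) / 2 * sqrt (2 / (1 + \<eta>)) ^ (CARD('n) + 2) * G
      \<le> integral (sublevel t) (\<lambda>x. t - f x) / sqrt t ^ (CARD('n) + 2)
    \<and> integral (sublevel t) (\<lambda>x. t - f x) / sqrt t ^ (CARD('n) + 2)
      \<le> (1 - \<eta>) / 2 * sqrt (2 / (1 - \<eta>)) ^ (CARD('n) + 2) * G"
proof -
  have "\<forall>\<^sub>F t in at_right 0. 0 < t \<and> ellipsoid (2 / (1 + \<eta>) * t) \<subseteq> sublevel t
    \<and> sublevel t \<subseteq> ellipsoid (2 / (1 - \<eta>) * t)
    \<and> (\<forall>x\<in>ellipsoid (2 / (1 + \<eta>) * t). f x \<le> (1 + \<eta>) * (x \<bullet> (hessian f 0 *v x)) / 2)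
    \<and> (\<forall>x\<in>sublevel t. (1 - \<eta>) * (x \<bullet> (hessian f 0 *v x)) / 2 \<le> f x)"
    by (rule eventually_conj[OF eventually_at_right_less sublevel_between_ellipsoids[OF \<eta>]])
  then show ?thesis
  proof (rule eventually_mono, safe)
    fix t :: real assume t: "0 < t"
      and sub: "ellipsoid (2 / (1 + \<eta>) * t) \<subseteq> sublevel t" "sublevel t \<subseteq> ellipsoid (2 / (1 - \<eta>) * t)"
      and upper: "\<forall>x\<in>ellipsoid (2 / (1 + \<eta>) * t). f x \<le> (1 + \<eta>) * (x \<bullet> (hessian f 0 *v x)) / 2"
      and lower: "\<forall>x\<in>sublevel t. (1 - \<eta>) * (x \<bullet> (hessian f 0 *v x)) / 2 \<le> f x"
    define F where "F x = (if x \<in> sublevel t then t - f x else 0)" for x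
    have lm: "sublevel t \<in> lmeasurable"
      using sub(2) bounded_ellipsoid by (intro lmeasurable_sublevel) (rule bounded_subset)
    have "(\<lambda>x. t - f x) integrable_on sublevel t"
      by (rule integrable_on_bounded_continuous[where C = t, OF _ lm])
        (auto intro!: continuous_intros continuous_on_subset[OF continuous_on_f]
          simp: sublevel_def nonneg abs_le_iff)
    then have F_int: "F integrable_on UNIV"
      unfolding F_def by (simp add: integrable_restrict_UNIV)
    have V: "integral (sublevel t) (\<lambda>x. t - f x) = integral UNIV F"
      unfolding F_def by (simp add: integral_restrict_UNIV)
    have "(1 + \<eta>) / 2 * paraboloid_cap (2 / (1 + \<eta>) * t) x \<le> F x" for x
      unfolding F_def by (rule sublevel_integrand_between_caps(1)[OF \<eta> sub(1) upper lower])
    then have "(1 + \<eta>) / 2 * integral UNIV (paraboloid_cap (2 / (1 + \<eta>) * t)) \<le> integral UNIV F"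
      unfolding integral_mult_right[symmetric]
      by (intro integral_le[OF integrable_on_mult_right[OF paraboloid_cap_integrable] F_int])
    have "(1 + \<eta>) / 2 * sqrt (2 / (1 + \<eta>)) ^ (CARD('n) + 2) * G
        = (1 + \<eta>) / 2 * (integral UNIV (paraboloid_cap (2 / (1 + \<eta>) * t)) / sqrt t ^ (CARD('n) + 2))"
      using integral_paraboloid_cap_scaled[of "2 / (1 + \<eta>)" t] \<eta> t by (simp add: G_def)
    also have "\<dots> = (1 + \<eta>) / 2 * integral UNIV (paraboloid_cap (2 / (1 + \<eta>) * t)) / sqrt t ^ (CARD('n) + 2)"
      by simp
    also have "\<dots> \<le> integral UNIV F / sqrt t ^ (CARD('n) + 2)"
      using t \<open>(1 + \<eta>) / 2 * _ \<le> integral UNIV F\<close> by (intro divide_right_mono) simp_all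
    finally show "(1 + \<eta>) / 2 * sqrt (2 / (1 + \<eta>)) ^ (CARD('n) + 2) * G
        \<le> integral (sublevel t) (\<lambda>x. t - f x) / sqrt t ^ (CARD('n) + 2)"
      by (simp add: V)
    have "F x \<le> (1 - \<eta>) / 2 * paraboloid_cap (2 / (1 - \<eta>) * t) x" for x
      unfolding F_def by (rule sublevel_integrand_between_caps(2)[OF \<eta> sub(1) upper lower])
    then have "integral UNIV F \<le> (1 - \<eta>) / 2 * integral UNIV (paraboloid_cap (2 / (1 - \<eta>) * t))"
      unfolding integral_mult_right[symmetric]
      by (intro integral_le[OF F_int integrable_on_mult_right[OF paraboloid_cap_integrable]])
    then have "integral UNIV F / sqrt t ^ (CARD('n) + 2)
        \<le> (1 - \<eta>) / 2 * integral UNIV (paraboloid_cap (2 / (1 - \<eta>) * t)) / sqrt t ^ (CARD('n) + 2)"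
      using t by (intro divide_right_mono) simp_all
    also have "\<dots> = (1 - \<eta>) / 2 * (integral UNIV (paraboloid_cap (2 / (1 - \<eta>) * t)) / sqrt t ^ (CARD('n) + 2))"
      by simp
    also have "\<dots> = (1 - \<eta>) / 2 * sqrt (2 / (1 - \<eta>)) ^ (CARD('n) + 2) * G"
      using integral_paraboloid_cap_scaled[of "2 / (1 - \<eta>)" t] \<eta> t by (simp add: G_def)
    finally show "integral (sublevel t) (\<lambda>x. t - f x) / sqrt t ^ (CARD('n) + 2)
        \<le> (1 - \<eta>) / 2 * sqrt (2 / (1 - \<eta>)) ^ (CARD('n) + 2) * G"
      by (simp add: V)
  qed
qed

lemma volume_limit:
  "((\<lambda>t. integral (sublevel t) (\<lambda>x. t - f x) / sqrt t ^ (CARD('n) + 2))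
    \<longlongrightarrow> sqrt 2 ^ (CARD('n) + 2) * unit_ball_volume TYPE('n)
        / (real (CARD('n) + 2) * sqrt (det (hessian f 0)))) (at_right 0)"
proof -
  define G where "G = integral UNIV (paraboloid_cap 1)"
  have "((\<lambda>t. integral (sublevel t) (\<lambda>x. t - f x) / sqrt t ^ (CARD('n) + 2))
    \<longlongrightarrow> 1 / 2 * sqrt 2 ^ (CARD('n) + 2) * G) (at_right 0)"
    unfolding G_def
    by (rule tendsto_sandwich_param, rule eventually_volume_sublevel_bounds)
      (auto intro!: tendsto_eq_intros)
  moreover have "1 / 2 * sqrt 2 ^ (CARD('n) + 2) * G = sqrt 2 ^ (CARD('n) + 2) * unit_ball_volume TYPE('n)
      / (real (CARD('n) + 2) * sqrt (det (hessian f 0)))"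
    using det_hessian_pos by (simp add: G_def integral_paraboloid_cap_one field_simps)
  ultimately show ?thesis by simp
qed

end

theorem lemma8:
  fixes f :: "real^'n \<Rightarrow> real" and U :: "(real^'n) set"
  assumes U_open: "open U" and U_convex: "convex U" and U0: "0 \<in> U"
    and f_smooth: "smooth_on U f"
    and f_convex: "convex_on U f"
    and f_nonneg: "\<And>x. x \<in> U \<Longrightarrow> f x \<ge> 0"
    and f0: "f 0 = 0"
    and tangent: "grad f 0 = 0"
    and K_pos: "det (hessian f 0) > 0"
  defines "A \<equiv> (\<lambda>t. integral {x \<in> U. f x < t} (\<lambda>x. 1 :: real))"
    and "V \<equiv> (\<lambda>t. integral {x \<in> U. f x < t} (\<lambda>x. t - f x))"
    and "S \<equiv> (\<lambda>t. integral {x \<in> U. f x < t} (\<lambda>x. sqrt (1 + (norm (grad f x))\<^sup>2)))"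
    and "K \<equiv> det (hessian f 0)"
    and "\<omega> \<equiv> unit_ball_volume TYPE('n)"
    and "n \<equiv> CARD('n)"
  shows "((\<lambda>t. A t / sqrt t ^ n) \<longlongrightarrow> sqrt 2 ^ n * \<omega> / sqrt K) (at_right 0)
     \<and> ((\<lambda>t. V t / sqrt t ^ (n + 2)) \<longlongrightarrow> sqrt 2 ^ (n + 2) * \<omega> / (real (n + 2) * sqrt K)) (at_right 0)
     \<and> ((\<lambda>t. S t / sqrt t ^ n) \<longlongrightarrow> sqrt 2 ^ n * \<omega> / sqrt K) (at_right 0)"
proof -
  interpret convex_graph U f
    using assms by unfold_locales
  show ?thesis
    using area_limit volume_limit surface_limit
    unfolding A_def V_def S_def K_def \<omega>_def n_def sublevel_def by blast
qed

end
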